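(* Let $n\geq 3$ and let $\pi=(d_0,d_1,\ldots,d_{n-1})$ be a nonincreasing sequence of positive integers with $\sum_{i=0}^{n-1}d_i=2n$. If $0\leq \alpha<1$, then $$\rho(A_{\alpha}(\mathcal{U}^*_{\pi}))= \max\{\rho(A_{\alpha}(H))\mid H \text{ is a connected unicyclic graph with degree sequence } \pi\}.$$
   Context: All graphs are simple and undirected. For a graph $G$ with adjacency matrix $A(G)$ and diagonal degree matrix $D(G)$, and $\alpha\in[0,1]$, let $A_\alpha(G)=\alpha D(G)+(1-\alpha)A(G)$, and let $\rho(A_\alpha(G))$ denote its spectral radius. A unicyclic graph is a connected graph with exactly one cycle. The graph $\mathcal{U}^*_{\pi}$ is defined as follows. If $d_0=2$, then $\mathcal{U}^*_{\pi}=C_n$. If $d_0\geq 3$ and $d_1=2$, then $\mathcal{U}^*_{\pi}$ consists of a triangle together with $d_0-2$ paths hanging at one vertex of the triangle (each path attached by an edge from that vertex to an end vertex of the path), whose numbers of vertices differ pairwise by at most one, with $n$ vertices in total. If $d_1\geq 3$, take vertices $w_0,\ldots,w_{n-1}$; join $w_0$ to $w_1,\ldots,w_{d_0}$ and join $w_1$ to $w_2$; then, in increasing order of $i\geq 1$, join $w_i$ to the next unused vertices, namely $d_1-2$ new vertices for $i=1$, $d_2-2$ new vertices for $i=2$, and $d_i-1$ new vertices for $i\geq 3$ (new vertices taken in the order $w_{d_0+1},w_{d_0+2},\ldots$). Then $w_i$ has degree $d_i$ and the resulting graph is unicyclic with degree sequence $\pi$.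
   Formalization: The hypothesis d_2 ≥ 2 is added: if d_2 = 1, as for π = (4,1,1), no unicyclic graph has degree sequence π, so the maximum would be over the empty set. *)

theory Defs
  imports
    "Jordan_Normal_Form.Spectral_Radius"
    "Graph_Theory.Graph_Theory"
begin

text \<open>
  Simple undirected graphs are the library's \<^locale>\<open>pair_graph\<close>s: finite, loop-free, and with a
  symmetric arc relation, an edge \<open>uv\<close> being represented by the two arcs \<open>(u, v)\<close> and \<open>(v, u)\<close>.
  Matrices are indexed by \<open>{0..<n}\<close>, so graphs on \<open>n\<close> vertices are taken to have that vertex set;
  every graph on \<open>n\<close> vertices is isomorphic to one of these.
\<close>

definition adjacency_mat :: "nat pair_pre_digraph \<Rightarrow> real mat" where
  "adjacency_mat G = mat (card (pverts G)) (card (pverts G))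
     (\<lambda>(u, v). if (u, v) \<in> parcs G then 1 else 0)"

definition degree_mat :: "nat pair_pre_digraph \<Rightarrow> real mat" where
  "degree_mat G = mat (card (pverts G)) (card (pverts G))
     (\<lambda>(u, v). if u = v then real (out_degree (with_proj G) u) else 0)"

definition A_alpha :: "real \<Rightarrow> nat pair_pre_digraph \<Rightarrow> real mat" where
  "A_alpha \<alpha> G = \<alpha> \<cdot>\<^sub>m degree_mat G + (1 - \<alpha>) \<cdot>\<^sub>m adjacency_mat G"

definition rho_alpha :: "real \<Rightarrow> nat pair_pre_digraph \<Rightarrow> real" where
  "rho_alpha \<alpha> G = spectral_radius (map_mat complex_of_real (A_alpha \<alpha> G))"

text \<open>
  A cycle of an undirected graph is a subgraph, so it is identified with its set of undirected
  edges: the \<open>2k\<close> closed walks that traverse the same cycle of length \<open>k\<close> count once. Closed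
  walks \<open>u, v, u\<close>, which are cycles in the sense of \<^const>\<open>pre_digraph.cycle\<close>, are excluded by
  the length bound.
\<close>

definition cycle_edge_sets :: "'a pair_pre_digraph \<Rightarrow> 'a set set set" where
  "cycle_edge_sets G = {(\<lambda>(u, v). {u, v}) ` set p | p.
     pre_digraph.cycle (with_proj G) p \<and> 3 \<le> length p}"

definition unicyclic :: "'a pair_pre_digraph \<Rightarrow> bool" where
  "unicyclic G \<longleftrightarrow> pair_graph G \<and> Digraph_Component.connected (with_proj G) \<and>
     (\<exists>!C. C \<in> cycle_edge_sets G)"

definition has_degree_sequence :: "'a pair_pre_digraph \<Rightarrow> nat list \<Rightarrow> bool" where
  "has_degree_sequence G \<pi> \<longleftrightarrow>
     image_mset (out_degree (with_proj G)) (mset_set (pverts G)) = mset \<pi>"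

definition unicyclic_graphs :: "nat list \<Rightarrow> nat pair_pre_digraph set" where
  "unicyclic_graphs \<pi> = {H. pverts H = {0..<length \<pi>} \<and> unicyclic H \<and> has_degree_sequence H \<pi>}"

definition undirected :: "nat \<Rightarrow> (nat \<times> nat) set \<Rightarrow> nat pair_pre_digraph" where
  "undirected n E = \<lparr>pverts = {0..<n}, parcs = E \<union> E\<inverse>\<rparr>"

definition cycle_edges :: "nat \<Rightarrow> (nat \<times> nat) set" where
  "cycle_edges n = {(i, (i + 1) mod n) | i. i < n}"

text \<open>
  The triangle \<open>0, 1, 2\<close> with \<open>k\<close> paths hanging at \<open>0\<close>. The remaining vertices \<open>3, \<dots>, n - 1\<close> are
  dealt out cyclically: for \<open>r < k\<close> the \<open>r\<close>-th path is \<open>3 + r, 3 + r + k, 3 + r + 2k, \<dots>\<close>, so the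
  numbers of vertices of the paths differ by at most one.
\<close>

definition triangle_paths_edges :: "nat \<Rightarrow> nat \<Rightarrow> (nat \<times> nat) set" where
  "triangle_paths_edges n k = {(0, 1), (0, 2), (1, 2)} \<union>
     {(0, v) | v. 3 \<le> v \<and> v < 3 + k \<and> v < n} \<union>
     {(v, v + k) | v. 3 \<le> v \<and> v + k < n}"

text \<open>
  In the breadth-first construction \<open>w\<^sub>i\<close> is joined to \<open>new_count \<pi> i\<close> new vertices, which
  are taken consecutively starting from \<open>first_new \<pi> i\<close>.
\<close>

definition new_count :: "nat list \<Rightarrow> nat \<Rightarrow> nat" where
  "new_count \<pi> i = (if i = 0 then \<pi> ! 0 else if i \<le> 2 then \<pi> ! i - 2 else \<pi> ! i - 1)"

definition first_new :: "nat list \<Rightarrow> nat \<Rightarrow> nat" where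
  "first_new \<pi> i = 1 + (\<Sum>j<i. new_count \<pi> j)"

definition bfs_edges :: "nat list \<Rightarrow> (nat \<times> nat) set" where
  "bfs_edges \<pi> = {(1, 2)} \<union>
     {(i, v) | i v. i < length \<pi> \<and> first_new \<pi> i \<le> v \<and> v < first_new \<pi> i + new_count \<pi> i}"

definition U_star :: "nat list \<Rightarrow> nat pair_pre_digraph" where
  "U_star \<pi> = undirected (length \<pi>)
     (if \<pi> ! 0 = 2 then cycle_edges (length \<pi>)
      else if \<pi> ! 1 = 2 then triangle_paths_edges (length \<pi>) (\<pi> ! 0 - 2)
      else bfs_edges \<pi>)"

text \<open>
  Among the nonincreasing positive sequences of length \<open>n \<ge> 3\<close> with sum \<open>2n\<close>, those with third
  entry \<open>1\<close>, such as \<open>(n + 1, 1, \<dots>, 1)\<close>, are not degree sequences of unicyclic graphs, and the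
  construction above makes no sense for them. The two lemmas below show that the maximum over
  \<^const>\<open>unicyclic_graphs\<close> is over a finite set, which is empty for those sequences.
\<close>

lemma finite_unicyclic_graphs: "finite (unicyclic_graphs \<pi>)"
proof -
  let ?V = "{0..<length \<pi>}"
  have "H \<in> (\<lambda>E. \<lparr>pverts = ?V, parcs = E\<rparr>) ` Pow (?V \<times> ?V)" if "H \<in> unicyclic_graphs \<pi>" for H
  proof -
    from that have V: "pverts H = ?V" and "pair_graph H"
      by (auto simp: unicyclic_graphs_def unicyclic_def)
    from this(2) interpret pair_graph H .
    have "parcs H \<subseteq> ?V \<times> ?V" using in_arcsD1 in_arcsD2 V by auto
    moreover have "H = \<lparr>pverts = ?V, parcs = parcs H\<rparr>" using V by simp
    ultimately show ?thesis by blast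
  qed
  then have "unicyclic_graphs \<pi> \<subseteq> (\<lambda>E. \<lparr>pverts = ?V, parcs = E\<rparr>) ` Pow (?V \<times> ?V)" by blast
  then show ?thesis by (rule finite_subset) simp
qed

lemma unicyclic_graphs_empty:
  assumes "3 \<le> length \<pi>" "sorted_wrt (\<ge>) \<pi>" "\<pi> ! 2 < 2"
  shows "unicyclic_graphs \<pi> = {}"
proof (rule ccontr)
  assume "unicyclic_graphs \<pi> \<noteq> {}"
  then obtain H where H: "pverts H = {0..<length \<pi>}" "unicyclic H" "has_degree_sequence H \<pi>"
    by (auto simp: unicyclic_graphs_def)
  from H(2) interpret pair_graph H by (simp add: unicyclic_def)
  obtain u p where p: "awalk u p u" "distinct (tl (pawalk_verts u p))" "3 \<le> length p"
    using H(2) unfolding unicyclic_def cycle_edge_sets_def cycle_def by auto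
  obtain e1 e2 e3 es where pe: "p = e1 # e2 # e3 # es"
    using p(3) by (auto simp: numeral_3_eq_3 Suc_le_length_iff)
  have vs: "tl (pawalk_verts u p) = map snd p"
    using p(1) awalk_verts_conv'[of u p u] pe by (simp add: awalk_def)
  have dst: "distinct (map snd p)" using p(2) vs by simp
  have arcs: "set p \<subseteq> parcs H" using p(1) by (simp add: awalk_def)
  have fin: "finite {a \<in> parcs H. fst a = v}" for v using pair_finite_arcs by simp
  have two: "2 \<le> out_degree (with_proj H) v" if "(x, v) \<in> parcs H" "(v, y) \<in> parcs H" "x \<noteq> y" for x v y
  proof -
    have "(v, x) \<in> parcs H" using that(1) pair_sym_arcs
      by (auto simp: symmetric_def dest: symD)
    then have "{(v, x), (v, y)} \<subseteq> {a \<in> parcs H. fst a = v}" using that by auto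
    from card_mono[OF fin this] that(3) show ?thesis
      by (simp add: out_degree_def out_arcs_def)
  qed
  have last: "snd (last p) = u"
  proof -
    have "awlast u p = u" using p(1) awalk_def by auto
    then show ?thesis using pe p(1) by (auto simp: awalk_verts_conv)
  qed
  have chain: "fst e1 = u" "fst e2 = snd e1" "fst e3 = snd e2"
    using p(1) pe by (auto simp: awalk_def)
  define S where "S = {snd e1, snd e2, u}"
  have lastin: "last p \<in> set (e3 # es)" using pe by simp
  have ne: "snd e1 \<noteq> snd e2" "snd e1 \<noteq> u" "snd e2 \<noteq> u" "snd e1 \<noteq> snd e3" "snd e2 \<noteq> snd e3"
    using dst pe last lastin by (auto simp: image_iff)
  have lp: "(fst (last p), u) \<in> parcs H"
  proof -
    have "last p \<in> set p" using pe by simp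
    then have "(fst (last p), snd (last p)) \<in> parcs H" using arcs by auto
    then show ?thesis unfolding last .
  qed
  have e: "(u, snd e1) \<in> parcs H" "(snd e1, snd e2) \<in> parcs H" "(snd e2, snd e3) \<in> parcs H"
    using arcs pe chain by (cases e1; cases e2; cases e3; simp)+
  have "fst (last p) \<noteq> snd e1"
  proof
    assume a: "fst (last p) = snd e1"
    show False
    proof (cases es rule: rev_cases)
      case Nil
      then show ?thesis using a pe chain ne by simp
    next
      case (snoc ys l)
      have "cas (snd e3) es u" using p(1) pe by (auto simp: awalk_def)
      then have "fst l = snd (last (e3 # ys))"
        unfolding snoc by (induct ys arbitrary: e3) auto
      moreover have "last p = l" using pe snoc by simp
      moreover have "snd (last (e3 # ys)) \<in> snd ` set (e3 # ys)" by (intro imageI last_in_set) simp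
      ultimately have "snd e1 \<in> snd ` set (e3 # ys)" using a by simp
      then show ?thesis using dst pe snoc by auto
    qed
  qed
  then have degu: "2 \<le> out_degree (with_proj H) u" using two lp e(1) by blast
  have "\<forall>v\<in>S. 2 \<le> out_degree (with_proj H) v"
    using degu two[OF e(1) e(2)] two[OF e(2) e(3)] ne unfolding S_def by auto
  moreover have "S \<subseteq> pverts H" using e in_arcsD1 unfolding S_def by auto
  ultimately have "S \<subseteq> {v \<in> pverts H. 2 \<le> out_degree (with_proj H) v}" by auto
  moreover have "card S = 3" using ne unfolding S_def by simp
  ultimately have "3 \<le> card {v \<in> pverts H. 2 \<le> out_degree (with_proj H) v}"
    using card_mono[of "{v \<in> pverts H. 2 \<le> out_degree (with_proj H) v}" S] pair_finite_verts
    by simp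
  also have "\<dots> = size (filter_mset (\<lambda>d. 2 \<le> d)
      (image_mset (out_degree (with_proj H)) (mset_set (pverts H))))"
    using pair_finite_verts by (simp add: filter_mset_image_mset filter_mset_mset_set)
  also have "\<dots> = length (filter (\<lambda>d. 2 \<le> d) \<pi>)"
    using H(3) unfolding has_degree_sequence_def by (simp flip: mset_filter)
  also have "\<dots> = card {i. i < length \<pi> \<and> 2 \<le> \<pi> ! i}" by (rule length_filter_conv_card)
  also have "\<dots> \<le> card {0..<2::nat}"
  proof (rule card_mono)
    show "{i. i < length \<pi> \<and> 2 \<le> \<pi> ! i} \<subseteq> {0..<2}"
    proof
      fix i assume i: "i \<in> {i. i < length \<pi> \<and> 2 \<le> \<pi> ! i}"
      have "\<pi> ! i \<le> \<pi> ! 2" if "2 \<le> i"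
        using that i assms(2) by (cases "i = 2") (auto simp: sorted_wrt_iff_nth_less)
      then show "i \<in> {0..<2}" using i assms(3) by force
    qed
  qed simp
  finally show False by simp
qed

end

theory Submission
  imports Defs "HOL-Analysis.Convex"
begin

text \<open>
  Let \<open>x \<ge> 0\<close> consist of the absolute values of an eigenvector for an eigenvalue of maximal modulus of
  \<open>A\<^sub>\<alpha>(H)\<close>, so that \<open>\<rho>\<close> is at most the Rayleigh quotient of \<open>A\<^sub>\<alpha>(H)\<close> at \<open>x\<close>, and relabel \<open>H\<close>
  such that \<open>x\<close> is nonincreasing. By Abel summation in both indices the quadratic form at \<open>x\<close> of
  another graph is at least as large as soon as all sums over initial rectangles \<open>{..<j} \<times> {..<k}\<close> of
  its matrix are; no eigenvector of the other graph is involved. For \<open>j \<le> k\<close>, the number of arcs of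
  \<open>H\<close> from a \<open>j\<close>-set into a \<open>k\<close>-set containing it is at most the sum of the \<open>j\<close> largest degrees,
  and also at most \<open>g(j) + g(k)\<close>, where \<open>g(m)\<close> is the largest number of edges that \<open>m\<close> vertices of
  a unicyclic graph can span: \<open>g(2) = 1\<close> and \<open>g(m) = m\<close> for \<open>m \<ge> 3\<close>. If \<open>d\<^sub>0 \<ge> 3\<close>, the breadth-first
  graph attains, on its initial segments, the first bound when all new neighbours of the first \<open>j\<close>
  vertices are among the first \<open>k\<close>, and the second bound otherwise (for \<open>j \<ge> 2\<close>). When \<open>d\<^sub>1 = 2\<close> this
  graph is the triangle with paths. If \<open>d\<^sub>0 = 2\<close>, all graphs in question are 2-regular and have
  \<open>\<rho> = 2\<close>.
\<close>

section \<open>Spectral radius and quadratic forms\<close>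

lemma spectral_radius_nonneg:
  assumes "A \<in> carrier_mat n n" "0 < n"
  shows "0 \<le> spectral_radius A"
  using spectral_radius_mem_max(1)[OF assms] by auto

text \<open>The bound on matrix powers used below asks for spectral radius less than 1. Dividing by
  any \<open>t\<close> above the spectral radius arranges this, since eigenvalues scale with the
  matrix.\<close>

lemma spectral_radius_smult_less_1:
  assumes A: "A \<in> carrier_mat n n" and n: "0 < n" and t: "0 < t" "spectral_radius A < t"
  shows "spectral_radius (complex_of_real (1 / t) \<cdot>\<^sub>m A) < 1"
proof -
  let ?B = "complex_of_real (1 / t) \<cdot>\<^sub>m A"
  have B: "?B \<in> carrier_mat n n" using A by simp
  obtain k where k: "k \<in> spectrum ?B" "spectral_radius ?B = cmod k"
    using spectral_radius_mem_max(1)[OF B n] by auto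
  then obtain v where v: "v \<in> carrier_vec n" "v \<noteq> 0\<^sub>v n" "?B *\<^sub>v v = k \<cdot>\<^sub>v v"
    using A by (auto simp: spectrum_def eigenvalue_def eigenvector_def)
  have "A *\<^sub>v v = complex_of_real t \<cdot>\<^sub>v (?B *\<^sub>v v)"
    using A v(1,2) t(1) by (intro eq_vecI) (auto simp: scalar_prod_def sum_distrib_left)
  also have "\<dots> = (complex_of_real t * k) \<cdot>\<^sub>v v"
    using v by (simp add: smult_smult_assoc)
  finally have "complex_of_real t * k \<in> spectrum A"
    using A v by (auto simp: spectrum_def eigenvalue_def eigenvector_def)
  then have "cmod (complex_of_real t * k) \<le> spectral_radius A"
    using spectral_radius_mem_max(2)[OF A n] by blast
  then have "t * cmod k \<le> spectral_radius A" using t(1) by (simp add: norm_mult)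
  then have "t * cmod k < t * 1" using t(2) by linarith
  then show ?thesis using t(1) k(2) by (simp only: mult_less_cancel_left_pos)
qed

text \<open>Taking absolute values in row \<open>i\<close> of the eigenvector equation gives
  \<open>cmod k * x i\<close> \<le> the \<open>i\<close>-th entry of \<open>A\<close> applied to
  \<open>x\<close>, by the triangle inequality and nonnegativity of the entries. Weighting the rows
  by \<open>x i\<close> and summing yields the claim.\<close>

lemma abs_eigenvector_quadratic_form:
  fixes A :: "real mat"
  assumes A: "A \<in> carrier_mat n n" and n: "0 < n"
    and nonneg: "\<And>i j. i < n \<Longrightarrow> j < n \<Longrightarrow> 0 \<le> A $$ (i, j)"
  obtains x :: "nat \<Rightarrow> real" where "\<forall>i. 0 \<le> x i" "0 < (\<Sum>i<n. x i * x i)"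
    "spectral_radius (map_mat complex_of_real A) * (\<Sum>i<n. x i * x i)
      \<le> (\<Sum>i<n. \<Sum>j<n. A $$ (i, j) * x i * x j)"
proof -
  let ?C = "map_mat complex_of_real A"
  have C: "?C \<in> carrier_mat n n" using A by simp
  obtain k where k: "k \<in> spectrum ?C" "spectral_radius ?C = cmod k"
    using spectral_radius_mem_max(1)[OF C n] by auto
  then obtain v where v: "v \<in> carrier_vec n" "v \<noteq> 0\<^sub>v n" "?C *\<^sub>v v = k \<cdot>\<^sub>v v"
    using A by (auto simp: spectrum_def eigenvalue_def eigenvector_def)
  define x where "x i = cmod (v $ i)" for i
  obtain i0 where "i0 < n" "v $ i0 \<noteq> 0"
    using v(1,2) by (metis carrier_vecD eq_vecI index_zero_vec(1) index_zero_vec(2))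
  then have pos: "0 < (\<Sum>i<n. x i * x i)"
    by (intro sum_pos2[of _ i0]) (auto simp: x_def)
  have row: "cmod k * x i \<le> (\<Sum>j<n. A $$ (i, j) * x j)" if i: "i < n" for i
  proof -
    have "k * v $ i = (?C *\<^sub>v v) $ i" using v i by simp
    also have "\<dots> = (\<Sum>j<n. complex_of_real (A $$ (i, j)) * v $ j)"
      using A v(1) i by (auto simp: scalar_prod_def lessThan_atLeast0)
    finally have "cmod k * x i \<le> (\<Sum>j<n. cmod (complex_of_real (A $$ (i, j)) * v $ j))"
      unfolding x_def using norm_sum norm_mult by metis
    also have "\<dots> = (\<Sum>j<n. A $$ (i, j) * x j)"
      using nonneg i by (auto simp: x_def norm_mult intro!: sum.cong)
    finally show ?thesis .
  qed
  have "cmod k * (\<Sum>i<n. x i * x i) = (\<Sum>i<n. x i * (cmod k * x i))"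
    by (simp add: sum_distrib_left algebra_simps)
  also have "\<dots> \<le> (\<Sum>i<n. x i * (\<Sum>j<n. A $$ (i, j) * x j))"
    using row by (intro sum_mono mult_left_mono) (auto simp: x_def)
  also have "\<dots> = (\<Sum>i<n. \<Sum>j<n. A $$ (i, j) * x i * x j)"
    by (simp add: sum_distrib_left algebra_simps)
  finally show ?thesis using that[of x] pos k(2) by (auto simp: x_def)
qed

lemma pow_mat_Suc_left:
  assumes A: "A \<in> carrier_mat n n"
  shows "A ^\<^sub>m Suc k = A * A ^\<^sub>m k"
proof (induction k)
  case 0
  show ?case using A by simp
next
  case (Suc k)
  have "A ^\<^sub>m k \<in> carrier_mat n n" using A by simp
  then show ?case using Suc A by (metis assoc_mult_mat pow_mat.simps(2))
qed

text \<open>If \<open>r\<close> exceeded the spectral radius, then after rescaling the matrix the powers would stay bounded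
  while \<open>r > 1\<close>. But the squared norms \<open>S k\<close> of the iterates of \<open>y\<close> are log-convex by Cauchy--Schwarz,
  hence grow geometrically.\<close>

lemma quadratic_form_le_spectral_radius:
  fixes A :: "real mat"
  assumes A: "A \<in> carrier_mat n n"
    and sym: "\<And>i j. i < n \<Longrightarrow> j < n \<Longrightarrow> A $$ (i, j) = A $$ (j, i)"
    and y: "0 < (\<Sum>i<n. y i * y i)"
    and r: "r * (\<Sum>i<n. y i * y i) \<le> (\<Sum>i<n. \<Sum>j<n. A $$ (i, j) * y i * y j)"
  shows "r \<le> spectral_radius (map_mat complex_of_real A)"
proof (rule ccontr)
  let ?C = "map_mat complex_of_real A"
  assume less: "\<not> r \<le> spectral_radius ?C"
  have n: "0 < n" using y by (cases n) auto
  have C: "?C \<in> carrier_mat n n" using A by simp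
  \<comment> \<open>After division by \<open>t\<close> the spectral radius is below 1, while the
    Rayleigh quotient at \<open>y\<close> is still at least \<open>q = r / t > 1\<close>.\<close>
  obtain t where t: "spectral_radius ?C < t" "t < r" using less dense[of "spectral_radius ?C" r] by auto
  have t0: "0 < t" using t(1) spectral_radius_nonneg[OF C n] by simp
  define B where "B = complex_of_real (1 / t) \<cdot>\<^sub>m ?C"
  have B: "B \<in> carrier_mat n n" using A by (simp add: B_def)
  have "spectral_radius B < 1"
    unfolding B_def using spectral_radius_smult_less_1[OF C n t0 t(1)] .
  then obtain c where c: "\<And>k. norm_bound (B ^\<^sub>m k) c"
    using spectral_radius_jnf_norm_bound_less_1_upper_triangular[OF B] by blast
  define q where "q = r / t"
  have q: "1 < q" using t t0 by (simp add: q_def)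
  define v where "v k = (\<lambda>i. Re ((B ^\<^sub>m k *\<^sub>v vec n (\<lambda>i. complex_of_real (y i))) $ i))" for k
  have v0: "v 0 i = y i" if "i < n" for i using that B by (simp add: v_def)
  \<comment> \<open>Both conjuncts go through one induction: the recursion for the real parts holds
    because the iterates of the real vector \<open>y\<close> are themselves real.\<close>
  have vk: "(B ^\<^sub>m k *\<^sub>v vec n (\<lambda>i. complex_of_real (y i))) $ i = complex_of_real (v k i)
      \<and> v (Suc k) i = (\<Sum>j<n. A $$ (i, j) / t * v k j)" if i: "i < n" for i k
    using i
  proof (induction k arbitrary: i)
    case 0
    let ?Y = "vec n (\<lambda>i. complex_of_real (y i))"
    have "(B *\<^sub>v ?Y) $ i = complex_of_real (\<Sum>j<n. A $$ (i, j) / t * y j)"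
      using A 0 by (simp add: B_def scalar_prod_def lessThan_atLeast0)
    then show ?case using 0 B v0 by (simp add: v_def)
  next
    case (Suc k)
    let ?Y = "vec n (\<lambda>i. complex_of_real (y i))"
    have step: "(B ^\<^sub>m Suc k *\<^sub>v ?Y) $ i = complex_of_real (\<Sum>j<n. A $$ (i, j) / t * v k j)"
      if IH: "\<And>i. i < n \<Longrightarrow> (B ^\<^sub>m k *\<^sub>v ?Y) $ i = complex_of_real (v k i)" and i: "i < n" for i k
    proof -
      have "B ^\<^sub>m Suc k *\<^sub>v ?Y = B *\<^sub>v (B ^\<^sub>m k *\<^sub>v ?Y)"
        using B by (simp only: pow_mat_Suc_left) (simp add: assoc_mult_mat_vec[of _ n n _ n])
      moreover have "dim_row (B ^\<^sub>m k) = n" using B by simp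
      ultimately show ?thesis
        using A IH i by (simp add: B_def scalar_prod_def lessThan_atLeast0)
    qed
    have 1: "(B ^\<^sub>m Suc k *\<^sub>v ?Y) $ i = complex_of_real (v (Suc k) i)" if "i < n" for i
    proof -
      have "(B ^\<^sub>m Suc k *\<^sub>v ?Y) $ i = complex_of_real (\<Sum>j<n. A $$ (i, j) / t * v k j)"
        using step Suc.IH that by blast
      then show ?thesis unfolding v_def by simp
    qed
    have "v (Suc (Suc k)) i = Re ((B ^\<^sub>m Suc (Suc k) *\<^sub>v ?Y) $ i)" unfolding v_def ..
    also have "\<dots> = (\<Sum>j<n. A $$ (i, j) / t * v (Suc k) j)"
      using step[OF 1] Suc.prems by simp
    finally show ?case using 1 Suc.prems by blast
  qed
  have rec: "v (Suc k) i = (\<Sum>j<n. A $$ (i, j) / t * v k j)" if "i < n" for i k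
    using vk that by blast
  define S where "S k = (\<Sum>i<n. v k i * v k i)" for k
  \<comment> \<open>Symmetry moves one factor of the matrix across the inner product. In particular
    the inner product of \<open>v k\<close> and \<open>v (k + 2)\<close> is
    \<open>S (k + 1)\<close>.\<close>
  have adj: "(\<Sum>i<n. v (Suc k) i * v l i) = (\<Sum>i<n. v k i * v (Suc l) i)" for k l
  proof -
    have "(\<Sum>i<n. v (Suc k) i * v l i) = (\<Sum>i<n. \<Sum>j<n. A $$ (i, j) / t * v k j * v l i)"
      by (simp add: rec sum_distrib_right)
    also have "\<dots> = (\<Sum>j<n. \<Sum>i<n. A $$ (i, j) / t * v k j * v l i)" by (rule sum.swap)
    also have "\<dots> = (\<Sum>j<n. v k j * v (Suc l) j)"
      using sym by (auto simp: rec sum_distrib_left intro!: sum.cong)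
    finally show ?thesis .
  qed
  have CS: "(\<Sum>i<n. v k i * v l i)\<^sup>2 \<le> S k * S l" for k l
    using Cauchy_Schwarz_ineq_sum[of "v k" "v l" "{..<n}"]
    by (simp add: S_def power2_eq_square)
  have S0: "S 0 = (\<Sum>i<n. y i * y i)" by (simp add: S_def v0)
  \<comment> \<open>The base case bounds \<open>q * S 0\<close> by the inner product of
    \<open>v 0\<close> and \<open>v 1\<close>. Log-convexity then hands the ratio
    \<open>q\<^sup>2\<close> on from step to step; positivity is carried along so that
    \<open>S k\<close> can be cancelled.\<close>
  have grow: "0 < S k \<and> q\<^sup>2 * S k \<le> S (Suc k)" for k
  proof (induction k)
    case 0
    have "q * S 0 \<le> (\<Sum>i<n. v 0 i * v 1 i)"
    proof -
      have "(\<Sum>i<n. v 0 i * v 1 i) = (\<Sum>i<n. \<Sum>j<n. A $$ (i, j) * y i * y j) / t"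
        by (simp add: rec v0 sum_distrib_left sum_divide_distrib algebra_simps)
      then show ?thesis using r t0 by (simp add: q_def S0 divide_right_mono)
    qed
    then have "(q * S 0)\<^sup>2 \<le> (\<Sum>i<n. v 0 i * v 1 i)\<^sup>2"
      using q y S0 by (intro power_mono) auto
    also have "\<dots> \<le> S 0 * S 1" by (rule CS)
    finally have "S 0 * (q\<^sup>2 * S 0) \<le> S 0 * S 1" by (simp add: power2_eq_square algebra_simps)
    then show ?case using y S0 by simp
  next
    case (Suc k)
    have pos: "0 < S (Suc k)"
      using Suc q by (intro less_le_trans[of 0 "q\<^sup>2 * S k" "S (Suc k)"]) auto
    have "(S (Suc k))\<^sup>2 \<le> S k * S (Suc (Suc k))"
      using CS[of k "Suc (Suc k)"] adj[of k "Suc k"] by (simp add: S_def)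
    moreover have "(q\<^sup>2 * S k) * S (Suc k) \<le> (S (Suc k))\<^sup>2"
      using Suc pos unfolding power2_eq_square[of "S (Suc k)"] by (intro mult_right_mono) auto
    ultimately have "S k * (q\<^sup>2 * S (Suc k)) \<le> S k * S (Suc (Suc k))" by (simp add: algebra_simps)
    then show ?case using pos Suc by simp
  qed
  have lower: "(q\<^sup>2) ^ k * S 0 \<le> S k" for k
  proof (induction k)
    case (Suc k)
    have "(q\<^sup>2) ^ Suc k * S 0 = q\<^sup>2 * ((q\<^sup>2) ^ k * S 0)" by simp
    also have "\<dots> \<le> q\<^sup>2 * S k" using Suc by (intro mult_left_mono) auto
    also have "\<dots> \<le> S (Suc k)" using grow by blast
    finally show ?case .
  qed simp
  \<comment> \<open>The entries of all powers of \<open>B\<close> are bounded by \<open>c\<close>,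
    so \<open>M\<close> bounds every entry of every iterate, independently of
    \<open>k\<close>.\<close>
  define M where "M = (\<Sum>j<n. c * \<bar>y j\<bar>)"
  have bound: "\<bar>v k i\<bar> \<le> M" if i: "i < n" for k i
  proof -
    have "(B ^\<^sub>m k *\<^sub>v vec n (\<lambda>i. complex_of_real (y i))) $ i
        = (\<Sum>j<n. (B ^\<^sub>m k) $$ (i, j) * complex_of_real (y j))"
      using B i by (simp add: scalar_prod_def lessThan_atLeast0)
    then have "\<bar>v k i\<bar> \<le> cmod (\<Sum>j<n. (B ^\<^sub>m k) $$ (i, j) * complex_of_real (y j))"
      unfolding v_def using abs_Re_le_cmod by metis
    also have "\<dots> \<le> (\<Sum>j<n. cmod ((B ^\<^sub>m k) $$ (i, j) * complex_of_real (y j)))"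
      by (rule norm_sum)
    also have "\<dots> \<le> M"
      unfolding M_def using c[of k] B i
      by (intro sum_mono) (auto simp: norm_mult norm_bound_def intro!: mult_right_mono)
    finally show ?thesis .
  qed
  have upper: "S k \<le> real n * M\<^sup>2" for k
  proof -
    have "S k \<le> (\<Sum>i<n. M\<^sup>2)"
      unfolding S_def power2_eq_square[symmetric] using bound
      by (intro sum_mono) (metis lessThan_iff abs_ge_zero power_mono power2_abs)
    then show ?thesis by simp
  qed
  obtain k where "real n * M\<^sup>2 / S 0 < (q\<^sup>2) ^ k"
    using real_arch_pow[of "q\<^sup>2"] q by (auto simp: one_less_power)
  then have "real n * M\<^sup>2 < (q\<^sup>2) ^ k * S 0" using y S0 by (simp add: divide_less_eq)
  then show False using lower[of k] upper[of k] by linarith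
qed

section \<open>Nonincreasing weights\<close>

text \<open>Abel summation in the form of an induction: the weighted sum up to \<open>k\<close> is
  at least \<open>y k\<close> times the partial sum. Passing to the smaller weight
  \<open>y (Suc k)\<close> only lowers that product, as partial sums are nonnegative.\<close>

lemma sum_mult_antimono_nonneg:
  fixes c y :: "nat \<Rightarrow> real"
  assumes partial: "\<And>j. j \<le> n \<Longrightarrow> 0 \<le> (\<Sum>i<j. c i)"
    and nonneg: "\<And>i. i < n \<Longrightarrow> 0 \<le> y i"
    and anti: "\<And>i j. i \<le> j \<Longrightarrow> j < n \<Longrightarrow> y j \<le> y i"
  shows "0 \<le> (\<Sum>i<n. c i * y i)"
proof (cases n)
  case (Suc m)
  have "y k * (\<Sum>i<Suc k. c i) \<le> (\<Sum>i<Suc k. c i * y i)" if "k < n" for k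
    using that
  proof (induction k)
    case (Suc k)
    have "y (Suc k) * (\<Sum>i<Suc k. c i) \<le> y k * (\<Sum>i<Suc k. c i)"
      using Suc.prems anti[of k "Suc k"] partial[of "Suc k"] by (intro mult_right_mono) auto
    then show ?case using Suc by (simp add: algebra_simps)
  qed simp
  from this[of m] have "y m * (\<Sum>i<n. c i) \<le> (\<Sum>i<n. c i * y i)" by (simp add: Suc)
  moreover have "0 \<le> y m * (\<Sum>i<n. c i)" using partial[of n] nonneg[of m] Suc by simp
  ultimately show ?thesis by linarith
qed simp

text \<open>The one-dimensional statement is applied twice: first along columns for each initial
  block of rows, then along rows to the resulting sums.\<close>

lemma quadratic_form_antimono_nonneg:
  fixes m :: "nat \<Rightarrow> nat \<Rightarrow> real" and y :: "nat \<Rightarrow> real"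
  assumes rectangle: "\<And>j k. j \<le> n \<Longrightarrow> k \<le> n \<Longrightarrow> 0 \<le> (\<Sum>i<j. \<Sum>l<k. m i l)"
    and nonneg: "\<And>i. i < n \<Longrightarrow> 0 \<le> y i"
    and anti: "\<And>i j. i \<le> j \<Longrightarrow> j < n \<Longrightarrow> y j \<le> y i"
  shows "0 \<le> (\<Sum>i<n. \<Sum>l<n. m i l * y i * y l)"
proof -
  have "0 \<le> (\<Sum>i<j. \<Sum>l<n. m i l * y l)" if "j \<le> n" for j
  proof -
    have "0 \<le> (\<Sum>l<n. (\<Sum>i<j. m i l) * y l)"
    proof (rule sum_mult_antimono_nonneg)
      show "0 \<le> (\<Sum>l<k. \<Sum>i<j. m i l)" if "k \<le> n" for k
        using rectangle[OF \<open>j \<le> n\<close> that] by (subst sum.swap)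
    qed (use nonneg anti in auto)
    then show ?thesis by (subst sum.swap) (simp add: sum_distrib_right)
  qed
  then have "0 \<le> (\<Sum>i<n. (\<Sum>l<n. m i l * y l) * y i)"
    using nonneg anti by (intro sum_mult_antimono_nonneg) auto
  then show ?thesis by (simp add: sum_distrib_left sum_distrib_right mult_ac)
qed

lemma ex_antimono_permutation:
  fixes x :: "nat \<Rightarrow> 'a::linorder"
  obtains \<sigma> where "bij_betw \<sigma> {..<n} {..<n}" "antimono_on {..<n} (x \<circ> \<sigma>)"
proof -
  define l where "l = rev (sort_key x [0..<n])"
  have "bij_betw (nth l) {..<n} {..<n}"
    by (rule bij_betw_nth) (auto simp: l_def)
  moreover have "x (l ! j) \<le> x (l ! i)" if "i \<le> j" "j < n" for i j
  proof -
    have "sorted (map x (sort_key x [0..<n]))" by simp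
    then have "map x (sort_key x [0..<n]) ! (n - Suc j) \<le> map x (sort_key x [0..<n]) ! (n - Suc i)"
      using that by (intro sorted_nth_mono) auto
    then show ?thesis using that by (simp add: l_def rev_nth)
  qed
  ultimately show ?thesis using that[of "nth l"] by (auto simp: monotone_on_def)
qed

text \<open>Exchange argument: the elements of \<open>A\<close> outside the initial segment are as
  many as those of the segment missing from \<open>A\<close>. The former have values at most
  \<open>f k\<close>, the latter at least \<open>f k\<close>.\<close>

lemma sum_antimono_le_initial:
  fixes f :: "nat \<Rightarrow> nat"
  assumes A: "A \<subseteq> {..<n}" and anti: "\<And>i j. i \<le> j \<Longrightarrow> j < n \<Longrightarrow> f j \<le> f i"
  shows "sum f A \<le> sum f {..<card A}"
proof -
  define k where "k = card A"
  have fin: "finite A" using A finite_subset by blast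
  have kn: "k \<le> n" using card_mono[OF _ A] by (simp add: k_def)
  let ?J = "{..<k}"
  have "card (A - ?J) = card (?J - A)"
    using card_Diff_subset_Int[of A ?J] card_Diff_subset_Int[of ?J A] fin
    by (simp add: k_def Int_commute)
  moreover have "sum f (A - ?J) \<le> of_nat (card (A - ?J)) * f k"
    using A anti by (intro sum_bounded_above) auto
  \<comment> \<open>Monotonicity is available only below \<open>n\<close>. An element of
    \<open>A\<close> outside the segment is at least \<open>k\<close>, which forces
    \<open>k < n\<close>.\<close>
  moreover have "of_nat (card (?J - A)) * f k \<le> sum f (?J - A)" if "A - ?J \<noteq> {}"
  proof -
    have "k < n" using that A by force
    then show ?thesis using anti by (intro sum_bounded_below) auto
  qed
  moreover have "sum f (A - ?J) = 0" if "A - ?J = {}" unfolding that by simp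
  ultimately have "sum f (A - ?J) \<le> sum f (?J - A)" by (cases "A - ?J = {}") auto
  moreover have "sum f A = sum f (A - ?J) + sum f (A \<inter> ?J)"
    using fin by (metis sum.Int_Diff add.commute)
  moreover have "sum f ?J = sum f (?J - A) + sum f (A \<inter> ?J)"
    by (metis sum.Int_Diff add.commute finite_lessThan Int_commute)
  ultimately show ?thesis by (simp add: k_def)
qed

section \<open>Cycles and edge counts in unicyclic graphs\<close>

lemma pcas_iff: "pcas u p v \<longleftrightarrow> map fst p @ [v] = u # map snd p"
  by (induct p arbitrary: u) auto

text \<open>For a closed walk the tails form \<open>u # t\<close> and the heads
  \<open>t @ [u]\<close>, which is the rotation of the tails. Neighbours along a cycle thus become a
  matter of list indices.\<close>

lemma (in pair_wf_digraph) cycle_iff_rotate1: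
  "cycle p \<longleftrightarrow> (\<exists>vs. vs \<noteq> [] \<and> distinct vs \<and> p = zip vs (rotate1 vs) \<and> set p \<subseteq> parcs G)"
proof
  assume "cycle p"
  then obtain u where u: "awalk u p u" "distinct (tl (pawalk_verts u p))" and p: "p \<noteq> []"
    unfolding cycle_def by blast
  have cas: "pcas u p u" and arcs: "set p \<subseteq> parcs G" using u(1) by (auto simp: awalk_def)
  from cas p obtain t where t: "map fst p = u # t" "map snd p = t @ [u]"
    unfolding pcas_iff by (cases p) auto
  have "distinct (map snd p)" using u(2) awalk_verts_conv'[OF cas] p by simp
  then have "distinct (map fst p)" using t by simp
  moreover have "p = zip (map fst p) (rotate1 (map fst p))"
    using t zip_map_fst_snd[of p] by (metis rotate1.simps(2))
  ultimately show "\<exists>vs. vs \<noteq> [] \<and> distinct vs \<and> p = zip vs (rotate1 vs) \<and> set p \<subseteq> parcs G"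
    using p arcs by (metis map_is_Nil_conv)
next
  assume "\<exists>vs. vs \<noteq> [] \<and> distinct vs \<and> p = zip vs (rotate1 vs) \<and> set p \<subseteq> parcs G"
  then obtain u t where ut: "distinct (u # t)" "p = zip (u # t) (t @ [u])" "set p \<subseteq> parcs G"
    by (metis neq_Nil_conv rotate1.simps(2))
  have maps: "map fst p = u # t" "map snd p = t @ [u]" using ut(2) by auto
  then have cas: "pcas u p u" unfolding pcas_iff by simp
  have "p \<noteq> []" using maps by auto
  moreover have "u \<in> pverts G"
    using maps ut(3) in_arcsD1 by (cases p) auto
  then have "awalk u p u" using cas ut(3) by (simp add: awalk_def)
  moreover have "distinct (tl (pawalk_verts u p))"
    using awalk_verts_conv'[OF cas] maps ut(1) by auto
  ultimately show "cycle p" unfolding cycle_def by blast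
qed

lemma (in pair_wf_digraph) cycle_edge_sets_rotate1:
  "cycle_edge_sets G = {(\<lambda>(u, v). {u, v}) ` set (zip vs (rotate1 vs)) | vs.
     distinct vs \<and> 3 \<le> length vs \<and> set (zip vs (rotate1 vs)) \<subseteq> parcs G}"
proof -
  have "vs \<noteq> []" if "3 \<le> length vs" for vs :: "'a list" using that by auto
  moreover have "length (zip vs (rotate1 vs)) = length vs" for vs :: "'a list" by simp
  ultimately show ?thesis
    unfolding cycle_edge_sets_def cycle_iff_rotate1 by (intro Collect_cong) metis
qed

lemma zip_rotate1_nth:
  assumes "i < length vs"
  shows "(vs ! i, vs ! (Suc i mod length vs)) \<in> set (zip vs (rotate1 vs))"
  using assms by (auto simp: set_zip nth_rotate1)

text \<open>\<open>x\<close> and \<open>y\<close> are the cyclic predecessor and successor of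
  \<open>v\<close>. They differ because a cycle of length at least 3 does not return after two
  steps.\<close>

lemma zip_rotate1_neighbours:
  assumes "distinct vs" "3 \<le> length vs" "v \<in> set vs"
  obtains x y where "x \<noteq> y" "(x, v) \<in> set (zip vs (rotate1 vs))" "(v, y) \<in> set (zip vs (rotate1 vs))"
proof -
  let ?n = "length vs"
  obtain j where j: "j < ?n" "v = vs ! j" using assms(3) by (metis in_set_conv_nth)
  define i where "i = (if j = 0 then ?n - 1 else j - 1)"
  have i: "i < ?n" "Suc i mod ?n = j" using j assms(2) by (auto simp: i_def)
  have "i \<noteq> Suc j mod ?n"
    using j assms(2) by (cases "Suc j = ?n") (auto simp: i_def)
  then have "vs ! i \<noteq> vs ! (Suc j mod ?n)"
    using assms i j(1) nth_eq_iff_index_eq[of vs i "Suc j mod ?n"] mod_less_divisor[of ?n "Suc j"] by fastforce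
  then show ?thesis
    using that zip_rotate1_nth[OF i(1)] zip_rotate1_nth[OF j(1)] i(2) j(2) by metis
qed

lemma set_zip_rotate1D:
  assumes "(x, y) \<in> set (zip vs (rotate1 vs))"
  shows "x \<in> set vs" "y \<in> set vs"
  using set_zip_leftD[OF assms] set_zip_rightD[OF assms] by simp_all

section \<open>Longest paths, forests and edge counts\<close>

lemma successively_zip_subset:
  assumes "successively (\<lambda>a b. (a, b) \<in> E) (x # xs)" "(last (x # xs), z) \<in> E"
  shows "set (zip (x # xs) (xs @ [z])) \<subseteq> E"
  using assms by (induction xs arbitrary: x) auto

text \<open>In a longest path all neighbours of the first vertex lie on the path, and one of them
  other than the second vertex closes a cycle. The premise \<open>deg\<close> expresses degree at
  least 2 without cardinalities; its negation directly yields a vertex with at most one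
  neighbour.\<close>

lemma ex_cycle_if_min_degree_2:
  assumes fin: "finite S" and ne: "S \<noteq> {}" and sym: "sym E" and irrefl: "irrefl E"
    and deg: "\<And>v w. v \<in> S \<Longrightarrow> \<exists>u\<in>S. u \<noteq> w \<and> (v, u) \<in> E"
  shows "\<exists>vs. distinct vs \<and> 3 \<le> length vs \<and> set vs \<subseteq> S \<and> set (zip vs (rotate1 vs)) \<subseteq> E"
proof -
  define P where "P vs \<longleftrightarrow> vs \<noteq> [] \<and> distinct vs \<and> set vs \<subseteq> S \<and> successively (\<lambda>a b. (a, b) \<in> E) vs" for vs
  obtain s where "s \<in> S" using ne by blast
  then have "P [s]" by (simp add: P_def)
  moreover have "length vs \<le> card S" if "P vs" for vs
    using that fin by (metis P_def card_mono distinct_card)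
  ultimately obtain vs where vs: "P vs" "\<And>ws. P ws \<Longrightarrow> length ws \<le> length vs"
    using ex_has_greatest_nat[of P "[s]" length "Suc (card S)"] by (auto simp: le_imp_less_Suc)
  then obtain v r where v: "vs = v # r" by (cases vs) (auto simp: P_def)
  have closed: "u \<in> set vs" if "u \<in> S" "(v, u) \<in> E" for u
  proof (rule ccontr)
    assume "u \<notin> set vs"
    then have "P (u # vs)" using vs(1) v that sym by (auto simp: P_def dest: symD)
    then show False using vs(2) by fastforce
  qed
  have vS: "v \<in> S" using vs(1) v by (simp add: P_def)
  show ?thesis
  proof (cases r)
    case Nil
    then show ?thesis using deg[OF vS, of v] closed v by auto
  next
    case (Cons w r')
    obtain u where u: "u \<in> S" "u \<noteq> w" "(v, u) \<in> E" using deg[OF vS] by blast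
    have "u \<noteq> v" using u irrefl by (auto simp: irrefl_def)
    then have "u \<in> set r'" using closed[OF u(1,3)] u(2) v Cons by auto
    then obtain xs ys where r': "r' = xs @ u # ys" by (meson split_list)
    \<comment> \<open>The cycle is the initial part of the path up to \<open>u\<close>, closed by
      the arc from \<open>u\<close> back to \<open>v\<close>.\<close>
    let ?c = "v # (w # xs @ [u])"
    have c: "vs = ?c @ ys" using v Cons r' by simp
    have "successively (\<lambda>a b. (a, b) \<in> E) ?c"
      using vs(1) unfolding P_def c successively_append_iff by blast
    moreover have "(last ?c, v) \<in> E" using u(3) sym by (auto dest: symD)
    ultimately have "set (zip ?c ((w # xs @ [u]) @ [v])) \<subseteq> E"
      by (rule successively_zip_subset)
    moreover have "rotate1 ?c = (w # xs @ [u]) @ [v]" by simp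
    moreover have "distinct ?c" "set ?c \<subseteq> S" using vs(1) unfolding P_def c by auto
    ultimately show ?thesis by (intro exI[of _ ?c]) (simp only:, simp)
  qed
qed

text \<open>A forest on m > 0 vertices has at most m - 1 edges, each counted as two arcs. The
  induction removes a vertex \<open>v\<close> whose only possible neighbour is \<open>w\<close>,
  losing at most two arcs.\<close>

lemma card_arcs_acyclic:
  assumes "finite S" "S \<noteq> {}" and sym: "sym E" and irrefl: "irrefl E"
    and acyclic: "\<And>vs. distinct vs \<Longrightarrow> 3 \<le> length vs \<Longrightarrow> \<not> set (zip vs (rotate1 vs)) \<subseteq> E"
  shows "card (E \<inter> S \<times> S) + 2 \<le> 2 * card S"
  using assms(1,2)
proof (induction "card S" arbitrary: S)
  case 0
  then show ?case by simp
next
  case (Suc m)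
  obtain v w where v: "v \<in> S" "\<And>u. u \<in> S \<Longrightarrow> (v, u) \<in> E \<Longrightarrow> u = w"
    using ex_cycle_if_min_degree_2[OF Suc.prems sym irrefl] acyclic by blast
  let ?S = "S - {v}"
  have fin: "finite (E \<inter> ?S \<times> ?S)" using Suc.prems(1) by blast
  have "E \<inter> S \<times> S \<subseteq> (E \<inter> ?S \<times> ?S) \<union> {(v, w), (w, v)}"
  proof
    fix e assume e: "e \<in> E \<inter> S \<times> S"
    obtain a b where ab: "e = (a, b)" by (cases e)
    have "(b, a) \<in> E" using e ab sym by (auto dest: symD)
    then show "e \<in> (E \<inter> ?S \<times> ?S) \<union> {(v, w), (w, v)}"
      using e ab v(2)[of a] v(2)[of b] by auto
  qed
  then have "card (E \<inter> S \<times> S) \<le> card ((E \<inter> ?S \<times> ?S) \<union> {(v, w), (w, v)})"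
    using fin by (intro card_mono) auto
  also have "\<dots> \<le> card (E \<inter> ?S \<times> ?S) + card {(v, w), (w, v)}" by (rule card_Un_le)
  also have "card {(v, w), (w, v)} \<le> 2"
    using card_length[of "[(v, w), (w, v)]"] by simp
  finally have le: "card (E \<inter> S \<times> S) \<le> card (E \<inter> ?S \<times> ?S) + 2" by simp
  have cS: "card S = Suc (card ?S)" using card.remove[OF Suc.prems(1) v(1)] .
  show ?case
  proof (cases "?S = {}")
    case True
    then have "S = {v}" using v(1) by blast
    then have "E \<inter> S \<times> S = {}" using irrefl by (auto simp: irrefl_def)
    then show ?thesis using cS by simp
  next
    case False
    have "card (E \<inter> ?S \<times> ?S) + 2 \<le> 2 * card ?S"
      using Suc.hyps(1)[of ?S] Suc.hyps(2) cS Suc.prems(1) False by simp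
    then show ?thesis using le cS by simp
  qed
qed

text \<open>Delete one edge of the unique cycle. A cycle that survived would have the same edge set
  and so contain the deleted edge. Hence a forest remains, and the deleted edge adds at most two
  arcs to the forest bound.\<close>

lemma unicyclic_card_arcs:
  assumes H: "unicyclic H" and S: "finite S"
  shows "card (parcs H \<inter> S \<times> S) \<le> 2 * card S"
proof (cases "S = {}")
  case False
  interpret pair_graph H using H by (simp add: unicyclic_def)
  obtain C where C: "C \<in> cycle_edge_sets H" "\<And>D. D \<in> cycle_edge_sets H \<Longrightarrow> D = C"
    using H unfolding unicyclic_def by blast
  then obtain vs where vs: "C = (\<lambda>(u, v). {u, v}) ` set (zip vs (rotate1 vs))" "3 \<le> length vs"
    "set (zip vs (rotate1 vs)) \<subseteq> parcs H"
    unfolding cycle_edge_sets_rotate1 by blast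
  obtain a b where ab: "(a, b) \<in> set (zip vs (rotate1 vs))"
    using zip_rotate1_nth[of 0 vs] vs(2) by fastforce
  have inC: "{a, b} \<in> C" using ab vs(1) by (force simp: image_iff)
  define E where "E = parcs H - {(a, b), (b, a)}"
  have "sym (parcs H)" using pair_sym_arcs by (simp add: symmetric_def)
  then have sym: "sym E" by (auto simp: E_def sym_def)
  have irrefl: "irrefl E" using no_loops' by (auto simp: E_def irrefl_def)
  have acyc: "\<not> set (zip ws (rotate1 ws)) \<subseteq> E" if ws: "distinct ws" "3 \<le> length ws" for ws
  proof
    assume sub: "set (zip ws (rotate1 ws)) \<subseteq> E"
    then have "(\<lambda>(u, v). {u, v}) ` set (zip ws (rotate1 ws)) \<in> cycle_edge_sets H"
      unfolding cycle_edge_sets_rotate1 using ws by (auto simp: E_def)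
    then have "C = (\<lambda>(u, v). {u, v}) ` set (zip ws (rotate1 ws))" using C(2) by simp
    then obtain c d where "(c, d) \<in> set (zip ws (rotate1 ws))" "{c, d} = {a, b}"
      using inC by force
    then show False using sub by (auto simp: E_def doubleton_eq_iff)
  qed
  have "card (parcs H \<inter> S \<times> S) \<le> card ((E \<inter> S \<times> S) \<union> {(a, b), (b, a)})"
    using S by (intro card_mono) (auto simp: E_def)
  also have "\<dots> \<le> card (E \<inter> S \<times> S) + card {(a, b), (b, a)}" by (rule card_Un_le)
  also have "card {(a, b), (b, a)} \<le> 2"
    using card_length[of "[(a, b), (b, a)]"] by simp
  finally show ?thesis using card_arcs_acyclic[OF S False sym irrefl acyc] by linarith
qed simp

text \<open>Write e(X, Y) for the number of arcs from X to Y and D for \<open>T - S\<close>. Then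
  e(S, T) = e(S, S) + e(S, D). The arcs within \<open>T\<close> include those from \<open>S\<close>
  to \<open>T\<close> and those from D to \<open>S\<close>, and the latter number e(S, D) by
  symmetry.\<close>

lemma sym_card_arcs_nested:
  assumes sym: "sym E" and T: "finite T" "S \<subseteq> T"
  shows "2 * card (E \<inter> S \<times> T) \<le> card (E \<inter> S \<times> S) + card (E \<inter> T \<times> T)"
proof -
  let ?D = "T - S"
  have S: "finite S" using T finite_subset by blast
  have "E \<inter> ?D \<times> S = prod.swap ` (E \<inter> S \<times> ?D)"
    using sym by (force simp: sym_def image_iff)
  then have swap: "card (E \<inter> ?D \<times> S) = card (E \<inter> S \<times> ?D)"
    by (simp add: card_image)
  have "E \<inter> S \<times> T = (E \<inter> S \<times> S) \<union> (E \<inter> S \<times> ?D)" using T(2) by blast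
  then have 1: "card (E \<inter> S \<times> T) = card (E \<inter> S \<times> S) + card (E \<inter> S \<times> ?D)"
    using S T(1) by (subst card_Un_disjoint[symmetric]) auto
  have "card ((E \<inter> S \<times> T) \<union> (E \<inter> ?D \<times> S)) \<le> card (E \<inter> T \<times> T)"
    using T by (intro card_mono) auto
  then have "card (E \<inter> S \<times> T) + card (E \<inter> ?D \<times> S) \<le> card (E \<inter> T \<times> T)"
    using S T(1) by (subst (asm) card_Un_disjoint) auto
  then show ?thesis using 1 swap by simp
qed

section \<open>The breadth-first graph\<close>

lemma first_new_0 [simp]: "first_new \<pi> 0 = 1"
  by (simp add: first_new_def)

lemma first_new_Suc: "first_new \<pi> (Suc i) = first_new \<pi> i + new_count \<pi> i"
  by (simp add: first_new_def)

lemma first_new_mono: "i \<le> j \<Longrightarrow> first_new \<pi> i \<le> first_new \<pi> j"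
  unfolding first_new_def by (intro add_left_mono sum_mono2) auto

lemma pair_graph_undirected:
  assumes "E \<subseteq> {0..<n} \<times> {0..<n}" "irrefl E"
  shows "pair_graph (undirected n E)"
proof -
  have "finite E" using assms(1) finite_subset by blast
  then have "finite (E \<union> E\<inverse>)" by simp
  then show ?thesis
    using assms by unfold_locales (auto simp: undirected_def irrefl_def symmetric_def sym_def)
qed

text \<open>Every positive vertex has a smaller neighbour, so descending always ends at 0.\<close>

lemma connected_undirected:
  assumes E: "E \<subseteq> {0..<n} \<times> {0..<n}" and n: "0 < n"
    and down: "\<And>v. 0 < v \<Longrightarrow> v < n \<Longrightarrow> \<exists>u<v. (u, v) \<in> E"
  shows "Digraph_Component.connected (with_proj (undirected n E))"
proof -
  let ?G = "undirected n E"
  interpret pair_wf_digraph ?G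
    using E by unfold_locales (auto simp: undirected_def)
  have sym: "symmetric (with_proj ?G)"
    by (auto simp: undirected_def symmetric_def sym_def)
  have verts: "pverts ?G = {0..<n}" by (simp add: undirected_def)
  have root: "reachable (with_proj ?G) 0 v" if "v < n" for v
    using that
  proof (induction v rule: less_induct)
    case (less v)
    show ?case
    proof (cases "v = 0")
      case True
      then show ?thesis using n verts by simp
    next
      case False
      then obtain u where u: "u < v" "(u, v) \<in> E" using down less.prems by blast
      have "reachable (with_proj ?G) 0 u" using less u by simp
      moreover have "(u, v) \<in> parcs ?G" using u by (simp add: undirected_def)
      ultimately show ?thesis by (rule reachable_adj_trans)
    qed
  qed
  show ?thesis
    unfolding connected_def
  proof (rule strongly_connectedI)
    show "verts (with_proj (mk_symmetric (with_proj ?G))) \<noteq> {}" using verts n by simp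
    fix u v
    assume "u \<in> verts (with_proj (mk_symmetric (with_proj ?G)))"
      "v \<in> verts (with_proj (mk_symmetric (with_proj ?G)))"
    then have "u < n" "v < n" by (simp_all add: verts)
    then have "reachable (with_proj ?G) u v"
      using reachable_trans[OF symmetric_reachable[OF sym root] root] by simp
    then show "reachable (with_proj (mk_symmetric (with_proj ?G))) u v"
      by (rule reachable_mk_symmetricI)
  qed
qed

text \<open>The case \<open>\<pi> ! 0 \<ge> 3\<close>, with \<open>\<pi> ! 1 = 2\<close> included.
  By \<open>third\<close> the subtractions of 2 in \<open>new_count\<close> are not truncated; by
  \<open>zeroth\<close> the vertices 1 and 2 are children of 0 and every later block of new vertices
  starts at 4 or beyond.\<close>

locale bfs_degrees =
  fixes \<pi> :: "nat list" and n :: nat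
  assumes length_seq: "length \<pi> = n" and three_le: "3 \<le> n"
    and antimono: "sorted_wrt (\<ge>) \<pi>" and pos: "\<And>d. d \<in> set \<pi> \<Longrightarrow> 0 < d"
    and sum_seq: "sum_list \<pi> = 2 * n"
    and third: "2 \<le> \<pi> ! 2" and zeroth: "3 \<le> \<pi> ! 0"
begin

lemma nth_antimono: "i \<le> j \<Longrightarrow> j < n \<Longrightarrow> \<pi> ! j \<le> \<pi> ! i"
  using antimono length_seq by (cases "i = j") (auto simp: sorted_wrt_iff_nth_less)

lemma nth_pos: "i < n \<Longrightarrow> 0 < \<pi> ! i"
  using pos length_seq by simp

lemma two_le_nth: "i \<le> 2 \<Longrightarrow> 2 \<le> \<pi> ! i"
  using nth_antimono[of i 2] third three_le by simp

text \<open>The construction uses up exactly the \<open>n\<close> vertices.\<close>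

lemma first_new_length: "first_new \<pi> n = n"
proof -
  \<comment> \<open>\<open>e j\<close> counts the neighbours of \<open>j\<close> that are not new:
    its parent if \<open>j > 0\<close>, and the other end of the extra edge if \<open>j\<close> is 1
    or 2. The total is 2 + 2 + (n - 3) = n + 1.\<close>
  define e :: "nat \<Rightarrow> nat" where "e j = (if j = 0 then 0 else if j \<le> 2 then 2 else 1)" for j
  have "new_count \<pi> j + e j = \<pi> ! j" if "j < n" for j
    using that two_le_nth[of j] nth_pos[of j] by (auto simp: new_count_def e_def)
  then have "(\<Sum>j<n. new_count \<pi> j) + (\<Sum>j<n. e j) = (\<Sum>j<n. \<pi> ! j)"
    by (simp flip: sum.distrib)
  also have "\<dots> = 2 * n"
    using sum_seq length_seq by (simp add: sum_list_sum_nth lessThan_atLeast0)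
  finally have "(\<Sum>j<n. new_count \<pi> j) + (\<Sum>j<n. e j) = 2 * n" .
  moreover have "(\<Sum>j<n. e j) = n + 1"
    using three_le
  proof (induction n rule: dec_induct)
    case base
    show ?case by (simp add: e_def numeral_3_eq_3)
  qed (simp add: e_def)
  ultimately show ?thesis by (simp add: first_new_def)
qed

lemma first_new_1: "first_new \<pi> (Suc 0) = Suc (\<pi> ! 0)"
  by (simp add: first_new_Suc new_count_def)

lemma four_le_first_new: "0 < i \<Longrightarrow> 4 \<le> first_new \<pi> i"
  using first_new_mono[of "Suc 0" i \<pi>] first_new_1 zeroth by simp

text \<open>The breadth-first queue does not run dry too early. If a vertex \<open>i > 2\<close>
  contributes no new vertex, its degree is 1, so are all later degrees, and \<open>first_new\<close>
  has already reached its final value \<open>n\<close>.\<close>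

lemma less_first_new: "i < n \<Longrightarrow> i < first_new \<pi> i"
proof (induction i)
  case (Suc i)
  show ?case
  proof (cases "i \<le> 2 \<or> 0 < new_count \<pi> i")
    case True
    then show ?thesis using Suc four_le_first_new[of "Suc i"] by (auto simp: first_new_Suc)
  next
    case False
    have "first_new \<pi> j = first_new \<pi> (Suc i)" if "Suc i \<le> j" "j \<le> n" for j
      using that
    proof (induction j rule: dec_induct)
      case (step j)
      have "\<pi> ! j \<le> \<pi> ! i" using step by (intro nth_antimono) auto
      then have "new_count \<pi> j = 0" using False step(1) by (auto simp: new_count_def)
      then show ?case using step by (simp add: first_new_Suc)
    qed simp
    from this[of n] show ?thesis using Suc.prems first_new_length by simp
  qed
qed simp

section \<open>Parents in the breadth-first tree\<close>

definition parent :: "nat \<Rightarrow> nat" where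
  "parent v = (LEAST i. v < first_new \<pi> (Suc i))"

text \<open>A Galois connection between \<open>parent\<close> and the monotone
  \<open>first_new\<close>. Blocks of new vertices may be empty, and the least index in
  \<open>parent\<close> picks the one that contains \<open>v\<close>.\<close>

lemma parent_less_iff:
  assumes "0 < v" "v < n"
  shows "parent v < j \<longleftrightarrow> v < first_new \<pi> j"
proof -
  obtain m where m: "n = Suc m" using assms by (cases n) auto
  have ex: "v < first_new \<pi> (Suc m)" using assms(2) first_new_length m by simp
  show ?thesis
  proof (cases j)
    case (Suc i)
    have "parent v \<le> i \<longleftrightarrow> v < first_new \<pi> (Suc i)"
    proof
      assume "parent v \<le> i"
      moreover have "v < first_new \<pi> (Suc (parent v))"
        unfolding parent_def by (rule LeastI[where P = "\<lambda>i. v < first_new \<pi> (Suc i)", OF ex])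
      ultimately show "v < first_new \<pi> (Suc i)"
        using first_new_mono[of "Suc (parent v)" "Suc i" \<pi>] by simp
    next
      assume "v < first_new \<pi> (Suc i)"
      then show "parent v \<le> i" unfolding parent_def by (rule Least_le)
    qed
    then show ?thesis by (simp add: Suc less_Suc_eq_le)
  qed (use assms in simp)
qed

lemma parent_eq_iff:
  assumes "0 < v" "v < n"
  shows "parent v = i \<longleftrightarrow> first_new \<pi> i \<le> v \<and> v < first_new \<pi> (Suc i)"
  using parent_less_iff[OF assms, of i] parent_less_iff[OF assms, of "Suc i"] by auto

lemma parent_less:
  assumes "0 < v" "v < n"
  shows "parent v < v"
  using parent_less_iff[OF assms, of v] less_first_new[of v] assms by simp

lemma parent_le_2:
  assumes "0 < v" "v \<le> 2"
  shows "parent v = 0"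
  using parent_less_iff[of v 1] four_le_first_new[of 1] assms three_le by simp

lemma mem_bfs_edges_iff:
  "(u, v) \<in> bfs_edges \<pi> \<longleftrightarrow> (u, v) = (1, 2) \<or> 0 < v \<and> v < n \<and> u = parent v"
proof -
  have "u < n \<and> first_new \<pi> u \<le> v \<and> v < first_new \<pi> (Suc u) \<longleftrightarrow> 0 < v \<and> v < n \<and> u = parent v"
  proof (cases "0 < v \<and> v < n")
    case True
    then show ?thesis using parent_eq_iff[of v u] parent_less[of v] by auto
  next
    case False
    have "1 \<le> first_new \<pi> u" using first_new_mono[of 0 u \<pi>] by simp
    moreover have "first_new \<pi> (Suc u) \<le> n" if "u < n"
      using first_new_mono[of "Suc u" n \<pi>] that first_new_length by simp
    ultimately show ?thesis using False by auto
  qed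
  then show ?thesis by (auto simp: bfs_edges_def length_seq first_new_Suc)
qed

section \<open>The graph itself: connectedness, degrees and its only cycle\<close>

definition bfs_graph :: "nat pair_pre_digraph" where
  "bfs_graph = undirected n (bfs_edges \<pi>)"

lemma mem_arcs_iff:
  "(u, v) \<in> parcs bfs_graph \<longleftrightarrow> (u, v) = (1, 2) \<or> (u, v) = (2, 1)
     \<or> 0 < v \<and> v < n \<and> u = parent v \<or> 0 < u \<and> u < n \<and> v = parent u"
  unfolding bfs_graph_def undirected_def using mem_bfs_edges_iff by auto

lemma bfs_edges_subset: "bfs_edges \<pi> \<subseteq> {0..<n} \<times> {0..<n}"
proof
  fix e assume "e \<in> bfs_edges \<pi>"
  then obtain u v where e: "e = (u, v)" "(u, v) = (1, 2) \<or> 0 < v \<and> v < n \<and> u = parent v"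
    using mem_bfs_edges_iff by (cases e) blast
  then show "e \<in> {0..<n} \<times> {0..<n}" using parent_less[of v] three_le by auto
qed

sublocale graph: pair_graph bfs_graph
  unfolding bfs_graph_def
proof (rule pair_graph_undirected[OF bfs_edges_subset])
  show "irrefl (bfs_edges \<pi>)"
  proof (rule irreflI)
    fix a
    show "(a, a) \<notin> bfs_edges \<pi>" using mem_bfs_edges_iff[of a a] parent_less[of a] by auto
  qed
qed

lemma pverts_bfs_graph: "pverts bfs_graph = {0..<n}"
  by (simp add: bfs_graph_def undirected_def)

lemma connected_bfs_graph: "Digraph_Component.connected (with_proj bfs_graph)"
  unfolding bfs_graph_def
proof (rule connected_undirected[OF bfs_edges_subset])
  show "0 < n" using three_le by simp
  fix v assume "0 < v" "v < n"
  then show "\<exists>u<v. (u, v) \<in> bfs_edges \<pi>"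
    using parent_less mem_bfs_edges_iff by blast
qed

lemma out_degree_bfs_graph:
  assumes i: "i < n"
  shows "out_degree (with_proj bfs_graph) i = \<pi> ! i"
proof -
  \<comment> \<open>\<open>D\<close> holds the children of \<open>i\<close> and \<open>P\<close> its
    other neighbours, namely the parent and the partner in the extra edge between 1 and 2.
    \<open>new_count\<close> subtracts exactly \<open>card P\<close> from the degree.\<close>
  define D where "D = {first_new \<pi> i..<first_new \<pi> (Suc i)}"
  define P where "P = (if i = 0 then {} else {parent i}) \<union> (if i = 1 then {2} else if i = 2 then {1} else {})"
  have D: "v \<in> D \<longleftrightarrow> 0 < v \<and> v < n \<and> i = parent v" for v
  proof (cases "0 < v \<and> v < n")
    case True
    then show ?thesis using parent_eq_iff[of v i] by (auto simp: D_def)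
  next
    case False
    have "1 \<le> first_new \<pi> i" using first_new_mono[of 0 i \<pi>] by simp
    moreover have "first_new \<pi> (Suc i) \<le> n"
      using first_new_mono[of "Suc i" n \<pi>] i first_new_length by simp
    ultimately show ?thesis using False by (auto simp: D_def)
  qed
  have par: "parent (Suc 0) = 0" "parent 2 = 0" using parent_le_2 by auto
  have "{e \<in> parcs bfs_graph. fst e = i} = Pair i ` (D \<union> P)"
    using i by (auto simp: mem_arcs_iff D P_def split: if_splits)
  then have "out_degree (with_proj bfs_graph) i = card (D \<union> P)"
    by (simp add: out_degree_def out_arcs_def card_image inj_on_def)
  also have "\<dots> = card D + card P"
  proof (rule card_Un_disjoint)
    \<comment> \<open>The parent of \<open>i\<close> is no child of \<open>i\<close>, as parents
      decrease strictly; and the extra edge is no tree edge, since 1 and 2 both have parent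
      0.\<close>
    have "parent i \<noteq> 0 \<longrightarrow> parent (parent i) < i" if "0 < i"
      using parent_less[of i] parent_less[of "parent i"] that i by auto
    then show "D \<inter> P = {}" using par by (auto simp: D P_def split: if_splits)
  qed (auto simp: D_def P_def)
  also have "card D = new_count \<pi> i" by (simp add: D_def first_new_Suc)
  also have "new_count \<pi> i + card P = \<pi> ! i"
    using par two_le_nth[of i] nth_pos[OF i] by (auto simp: P_def new_count_def)
  finally show ?thesis .
qed

lemma bfs_graph_degree_sequence: "has_degree_sequence bfs_graph \<pi>"
proof -
  have "image_mset (out_degree (with_proj bfs_graph)) (mset_set {0..<n})
      = image_mset (nth \<pi>) (mset_set {0..<n})"
    by (intro image_mset_cong) (simp add: out_degree_bfs_graph)
  also have "\<dots> = mset (map (nth \<pi>) [0..<n])" by (simp add: mset_upt)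
  also have "map (nth \<pi>) [0..<n] = \<pi>" using length_seq map_nth by blast
  finally show ?thesis unfolding has_degree_sequence_def pverts_bfs_graph .
qed

text \<open>The largest vertex of a cycle has two distinct smaller neighbours on it. A vertex above
  2 has only one smaller neighbour, its parent, so the cycle lives on 0, 1, 2.\<close>

lemma cycle_edge_sets_bfs_graph: "cycle_edge_sets bfs_graph = {{{0, 1}, {1, 2}, {0, 2}}}"
proof -
  have par: "parent (Suc 0) = 0" "parent 2 = 0" using parent_le_2 by auto
  have tri: "set vs = {0, 1, 2}"
    if vs: "distinct vs" "3 \<le> length vs" "set (zip vs (rotate1 vs)) \<subseteq> parcs bfs_graph" for vs
  proof -
    define M where "M = Max (set vs)"
    have M: "M \<in> set vs" "\<And>v. v \<in> set vs \<Longrightarrow> v \<le> M"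
      using Max_in[of "set vs"] Max_ge[of "set vs"] vs(2) unfolding M_def by fastforce+
    obtain x y where xy: "x \<noteq> y" "(x, M) \<in> set (zip vs (rotate1 vs))" "(M, y) \<in> set (zip vs (rotate1 vs))"
      using zip_rotate1_neighbours[OF vs(1,2) M(1)] .
    have arcs: "(x, M) \<in> parcs bfs_graph" "(M, y) \<in> parcs bfs_graph" using xy vs(3) by auto
    have le: "x \<le> M" "y \<le> M" 
      using M(2)[OF set_zip_rotate1D(1)[OF xy(2)]] M(2)[OF set_zip_rotate1D(2)[OF xy(3)]] .
    have "M \<le> 2"
    proof (rule ccontr)
      assume "\<not> M \<le> 2"
      then have "x = parent M" "y = parent M"
        using arcs le parent_less[of x] parent_less[of y] by (auto simp: mem_arcs_iff)
      then show False using xy(1) by simp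
    qed
    then have "set vs \<subseteq> {0, 1, 2}" using M(2) by force
    moreover have "card {0, 1, 2::nat} \<le> card (set vs)" using vs by (simp add: distinct_card)
    ultimately show ?thesis by (intro card_seteq) auto
  qed
  show ?thesis
  proof (intro equalityI subsetI)
    fix C assume "C \<in> cycle_edge_sets bfs_graph"
    then obtain vs where vs: "C = (\<lambda>(u, v). {u, v}) ` set (zip vs (rotate1 vs))"
      "distinct vs" "3 \<le> length vs" "set (zip vs (rotate1 vs)) \<subseteq> parcs bfs_graph"
      unfolding graph.cycle_edge_sets_rotate1 by blast
    have set: "set vs = {0, 1, 2}" using tri vs by blast
    then have "length vs = 3" using vs(2) distinct_card by fastforce
    then obtain a b c where abc: "vs = [a, b, c]"
      by (auto simp: numeral_3_eq_3 length_Suc_conv)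
    show "C \<in> {{{0, 1}, {1, 2}, {0, 2}}}"
    proof -
      have C: "C = {{a, b}, {b, c}, {c, a}}" using vs(1) by (simp add: abc)
      have "a \<in> {0, 1, 2}" "b \<in> {0, 1, 2}" "c \<in> {0, 1, 2}"
        unfolding set[symmetric] by (simp_all add: abc)
      moreover have "a \<noteq> b" "b \<noteq> c" "a \<noteq> c" using vs(2) by (simp_all add: abc)
      ultimately have "{{a, b}, {b, c}, {c, a}} = {{0, 1}, {1, 2}, {0, 2}}"
        unfolding insert_iff empty_iff by (elim disjE) (simp_all add: insert_commute)
      then show ?thesis using C by simp
    qed
  next
    fix C :: "nat set set" assume "C \<in> {{{0, 1}, {1, 2}, {0, 2}}}"
    then have "C = (\<lambda>(u, v). {u, v}) ` set (zip [0, 1, 2] (rotate1 [0, 1, 2]))"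
      by (simp add: insert_commute)
    moreover have "set (zip [0, 1, 2] (rotate1 [0, 1, 2])) \<subseteq> parcs bfs_graph"
      using par three_le by (auto simp: mem_arcs_iff)
    ultimately show "C \<in> cycle_edge_sets bfs_graph"
      unfolding graph.cycle_edge_sets_rotate1 by (intro CollectI exI[of _ "[0, 1, 2]"]) simp
  qed
qed

lemma bfs_graph_unicyclic: "bfs_graph \<in> unicyclic_graphs \<pi>"
proof -
  have "\<exists>!C. C \<in> cycle_edge_sets bfs_graph" unfolding cycle_edge_sets_bfs_graph singleton_iff
    by (rule ex1_eq)
  then have "unicyclic bfs_graph"
    unfolding unicyclic_def using graph.pair_graph connected_bfs_graph by blast
  then show ?thesis
    unfolding unicyclic_graphs_def using pverts_bfs_graph length_seq bfs_graph_degree_sequence by simp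
qed

section \<open>Arcs between initial segments of the breadth-first graph\<close>

lemma sum_seq_le_card_arcs:
  assumes "j \<le> k" "k \<le> n" "first_new \<pi> j \<le> k"
  shows "(\<Sum>i<j. \<pi> ! i) \<le> card (parcs bfs_graph \<inter> {..<j} \<times> {..<k})"
proof -
  \<comment> \<open>All arcs leaving the first \<open>j\<close> vertices end below \<open>k\<close>:
    children because \<open>first_new \<pi> j \<le> k\<close>, parents because they are smaller, and
    the extra edge because \<open>4 \<le> k\<close>.\<close>
  have sub: "(\<Union>i<j. {e \<in> parcs bfs_graph. fst e = i}) \<subseteq> {..<j} \<times> {..<k}"
  proof (intro subsetI)
    fix e assume "e \<in> (\<Union>i<j. {e \<in> parcs bfs_graph. fst e = i})"
    then obtain u v where uv: "e = (u, v)" "u < j" "(u, v) \<in> parcs bfs_graph" by (cases e) auto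
    have "4 \<le> k" using four_le_first_new[of j] uv(2) assms(3) by simp
    then have "v < k"
      using uv(2,3) assms parent_less_iff[of v j] parent_less[of u] by (auto simp: mem_arcs_iff)
    then show "e \<in> {..<j} \<times> {..<k}" using uv by simp
  qed
  have "(\<Sum>i<j. \<pi> ! i) = (\<Sum>i<j. card {e \<in> parcs bfs_graph. fst e = i})"
    using out_degree_bfs_graph assms by (intro sum.cong) (auto simp: out_degree_def out_arcs_def)
  also have "\<dots> = card (\<Union>i<j. {e \<in> parcs bfs_graph. fst e = i})"
    using graph.pair_finite_arcs by (intro card_UN_disjoint[symmetric]) auto
  also have "\<dots> \<le> card (parcs bfs_graph \<inter> {..<j} \<times> {..<k})"
    using sub by (intro card_mono) auto
  finally show ?thesis .
qed

text \<open>One vertex has at most \<open>k - 1\<close> neighbours in a \<open>k\<close>-set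
  containing it. This is less than the general edge bound allows, so one row is treated
  apart.\<close>

lemma card_arcs_first_vertex:
  assumes "k \<le> n" "k < first_new \<pi> 1"
  shows "k - 1 \<le> card (parcs bfs_graph \<inter> {..<1} \<times> {..<k})"
proof -
  have "Pair 0 ` {1..<k} \<subseteq> parcs bfs_graph \<inter> {..<1} \<times> {..<k}"
    using assms parent_less_iff[of _ 1] by (auto simp: mem_arcs_iff)
  then have "card (Pair (0::nat) ` {1..<k}) \<le> card (parcs bfs_graph \<inter> {..<1} \<times> {..<k})"
    by (intro card_mono) auto
  then show ?thesis by (simp add: card_image inj_on_def)
qed

text \<open>Three disjoint families are counted: \<open>k - 1\<close> arcs from parents to children
  (the parents lie below \<open>j\<close> because \<open>k < first_new \<pi> j\<close>),
  \<open>j - 1\<close> arcs from children to parents, and the 0, 1 or 2 arcs of the extra edge that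
  fit into the rectangle.\<close>

lemma card_arcs_initial:
  assumes "2 \<le> j" "j \<le> k" "k \<le> n" "k < first_new \<pi> j"
  shows "(if j = 2 then 1 else j) + (if k = 2 then 1 else k)
    \<le> card (parcs bfs_graph \<inter> {..<j} \<times> {..<k})"
proof -
  let ?R = "{..<j} \<times> {..<k}"
  define X where "X = (\<lambda>v. (parent v, v)) ` {1..<k}"
  define Y where "Y = (\<lambda>v. (v, parent v)) ` {1..<j}"
  define Z where "Z = {(1, 2), (2, 1)} \<inter> ?R"
  have par: "parent (Suc 0) = 0" "parent 2 = 0" using parent_le_2 by auto
  have fin: "finite X" "finite Y" "finite Z" by (auto simp: X_def Y_def Z_def)
  have X: "X \<subseteq> parcs bfs_graph \<inter> ?R"
    using assms parent_less_iff[of _ j] by (auto simp: X_def mem_arcs_iff)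
  have Y: "Y \<subseteq> parcs bfs_graph \<inter> ?R"
  proof
    fix e assume "e \<in> Y"
    then obtain v where v: "e = (v, parent v)" "1 \<le> v" "v < j" by (auto simp: Y_def)
    moreover have "parent v < v" using parent_less v assms by simp
    ultimately show "e \<in> parcs bfs_graph \<inter> ?R" using assms by (simp add: mem_arcs_iff)
  qed
  have Z: "Z \<subseteq> parcs bfs_graph \<inter> ?R" by (auto simp: Z_def mem_arcs_iff)
  have XY: "X \<inter> Y = {}"
  proof (rule ccontr)
    assume "X \<inter> Y \<noteq> {}"
    then obtain p where p: "p \<in> X" "p \<in> Y" by blast
    obtain v where v: "p = (parent v, v)" "1 \<le> v" "v < k" using p(1) by (auto simp: X_def)
    obtain u where u: "p = (u, parent u)" "1 \<le> u" "u < j" using p(2) by (auto simp: Y_def)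
    have "(parent v, v) = (u, parent u)" by (rule trans[OF v(1)[symmetric] u(1)])
    then have "parent v = u" "v = parent u" unfolding prod.inject by blast+
    moreover have "parent v < v" "parent u < u"
      using u v assms by (intro parent_less; simp)+
    ultimately show False by linarith
  qed
  have XYZ: "(X \<union> Y) \<inter> Z = {}" using par by (auto simp: X_def Y_def Z_def)
  have "(k - 1) + (j - 1) + card Z = card X + card Y + card Z"
    by (simp add: X_def Y_def card_image inj_on_def)
  also have "\<dots> = card (X \<union> Y \<union> Z)"
    using XY XYZ fin by (simp add: card_Un_disjoint)
  also have "\<dots> \<le> card (parcs bfs_graph \<inter> ?R)"
    using X Y Z by (intro card_mono) auto
  finally have "(k - 1) + (j - 1) + card Z \<le> card (parcs bfs_graph \<inter> ?R)" .
  moreover have "card Z = (if k = 2 then 0 else if j = 2 then 1 else 2)"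
  proof -
    have "Z = (if k = 2 then {} else if j = 2 then {(1, 2)} else {(1, 2), (2, 1)})"
      using assms by (auto simp: Z_def)
    then show ?thesis by simp
  qed
  ultimately show ?thesis using assms by (auto split: if_splits)
qed

text \<open>Here all degrees after the first are 2 or 1. From vertex 3 on each vertex of degree 2
  adds one new vertex, so parents are found \<open>k\<close> places earlier, which is how the paths
  are dealt out.\<close>

lemma triangle_paths_edges_eq_bfs_edges:
  assumes second: "\<pi> ! 1 = 2"
  shows "triangle_paths_edges n (\<pi> ! 0 - 2) = bfs_edges \<pi>"
proof -
  define k where "k = \<pi> ! 0 - 2"
  have k: "\<pi> ! 0 = k + 2" "0 < k" using zeroth by (auto simp: k_def)
  have two: "\<pi> ! 2 = 2" using nth_antimono[of 1 2] second third three_le by simp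
  have le2: "\<pi> ! i \<le> 2" if "3 \<le> i" "i < n" for i
    using nth_antimono[of 1 i] second that by simp
  have fn3: "first_new \<pi> 3 = 3 + k"
    using second two k by (simp add: first_new_Suc new_count_def numeral_3_eq_3 numeral_2_eq_2)
  have fn: "first_new \<pi> i = min n (i + k)" if "3 \<le> i" "i \<le> n" for i
    using that
  proof (induction i rule: dec_induct)
    case base
    then show ?case using fn3 first_new_mono[of 3 n \<pi>] first_new_length three_le by simp
  next
    case (step i)
    have le: "first_new \<pi> (Suc i) \<le> n"
      using first_new_mono[of "Suc i" n \<pi>] step.prems first_new_length by simp
    have IH: "first_new \<pi> i = min n (i + k)" using step by simp
    have i: "3 \<le> i" "i < n" using step by auto
    show ?case
    proof (cases "\<pi> ! i = 2")
      case True
      then show ?thesis using IH i le by (simp add: first_new_Suc new_count_def)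
    next
      \<comment> \<open>From the first degree 1 onwards nothing is added, so
        \<open>first_new\<close> already equals \<open>n\<close> and the minimum stays at
        \<open>n\<close>.\<close>
      case False
      then have 1: "\<pi> ! i = 1" using le2[OF i] nth_pos[OF i(2)] by simp
      have "first_new \<pi> j = first_new \<pi> i" if "i \<le> j" "j \<le> n" for j
        using that
      proof (induction j rule: dec_induct)
        case (step j)
        have "\<pi> ! j \<le> 1" using nth_antimono[of i j] step 1 by simp
        then show ?case using step i by (simp add: first_new_Suc new_count_def)
      qed simp
      from this[of n] this[of "Suc i"] show ?thesis
        using i IH first_new_length by (simp add: min_def split: if_splits)
    qed
  qed
  have fn12: "first_new \<pi> 1 = 3 + k" "first_new \<pi> 2 = 3 + k"
    using second k by (simp_all add: first_new_Suc new_count_def numeral_2_eq_2)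
  have kn: "3 + k \<le> n" using fn3 first_new_mono[of 3 n \<pi>] first_new_length three_le by simp
  have parent: "parent v = (if v < 3 + k then 0 else v - k)" if "0 < v" "v < n" for v
  proof (cases "v < 3 + k")
    case True
    then show ?thesis using parent_eq_iff[OF that, of 0] that fn12 by simp
  next
    case False
    then have "first_new \<pi> (v - k) = v" "first_new \<pi> (Suc (v - k)) = Suc v"
      using fn[of "v - k"] fn[of "Suc (v - k)"] that k by auto
    then show ?thesis using parent_eq_iff[OF that, of "v - k"] False by simp
  qed
  have "(u, v) \<in> triangle_paths_edges n k \<longleftrightarrow> (u, v) \<in> bfs_edges \<pi>" for u v
  proof -
    have "(u, v) \<in> triangle_paths_edges n k \<longleftrightarrow> (u, v) \<in> {(0, 1), (0, 2), (1, 2)}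
        \<or> u = 0 \<and> 3 \<le> v \<and> v < 3 + k \<and> v < n \<or> 3 \<le> u \<and> v = u + k \<and> v < n"
      by (auto simp: triangle_paths_edges_def)
    also have "\<dots> \<longleftrightarrow> (u, v) = (1, 2) \<or> 0 < v \<and> v < n \<and> u = (if v < 3 + k then 0 else v - k)"
      using kn k(2) by (cases "v < 3 + k") auto
    also have "\<dots> \<longleftrightarrow> (u, v) \<in> bfs_edges \<pi>"
      unfolding mem_bfs_edges_iff using parent[of v] by metis
    finally show ?thesis .
  qed
  then show ?thesis unfolding k_def by auto
qed

lemma U_star_eq_bfs_graph: "U_star \<pi> = bfs_graph"
  using zeroth triangle_paths_edges_eq_bfs_edges
  by (auto simp: U_star_def bfs_graph_def length_seq)

end

section \<open>Comparison of the matrices\<close>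

lemma A_alpha_carrier:
  "pverts G = {0..<n} \<Longrightarrow> A_alpha \<alpha> G \<in> carrier_mat n n"
  by (simp add: A_alpha_def degree_mat_def adjacency_mat_def)

lemma A_alpha_index:
  assumes "pverts G = {0..<n}" "i < n" "j < n"
  shows "A_alpha \<alpha> G $$ (i, j) = \<alpha> * (if i = j then real (out_degree (with_proj G) i) else 0)
    + (1 - \<alpha>) * (if (i, j) \<in> parcs G then 1 else 0)"
  using assms by (simp add: A_alpha_def degree_mat_def adjacency_mat_def)

text \<open>Degrees sit on the diagonal, of which a rectangle meets only \<open>min j k\<close>
  entries. The permutation serves for the relabelled graph; the identity gives the comparison
  graph.\<close>

lemma sum_A_alpha_rectangle:
  assumes V: "pverts G = {0..<n}" and \<sigma>: "bij_betw \<sigma> {..<n} {..<n}" and "j \<le> n" "k \<le> n"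
  shows "(\<Sum>i<j. \<Sum>l<k. A_alpha \<alpha> G $$ (\<sigma> i, \<sigma> l))
    = \<alpha> * real (\<Sum>v\<in>\<sigma> ` {..<min j k}. out_degree (with_proj G) v)
      + (1 - \<alpha>) * real (card (parcs G \<inter> \<sigma> ` {..<j} \<times> \<sigma> ` {..<k}))"
proof -
  let ?d = "\<lambda>i. real (out_degree (with_proj G) (\<sigma> i))"
  have inj: "inj_on \<sigma> {..<n}" and im: "\<And>i. i < n \<Longrightarrow> \<sigma> i < n"
    using \<sigma> by (auto simp: bij_betw_def)
  have inj': "inj_on \<sigma> {..<m}" if "m \<le> n" for m
    using inj_on_subset[OF inj] that by auto
  have "(\<Sum>i<j. \<Sum>l<k. A_alpha \<alpha> G $$ (\<sigma> i, \<sigma> l)) = (\<Sum>i<j. \<Sum>l<k. \<alpha> * (if i = l then ?d i else 0)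
      + (1 - \<alpha>) * (if (\<sigma> i, \<sigma> l) \<in> parcs G then 1 else 0))"
    using assms(3,4) V im inj
    by (intro sum.cong refl) (auto simp: A_alpha_index inj_on_eq_iff)
  also have "\<dots> = \<alpha> * (\<Sum>i<j. \<Sum>l<k. if i = l then ?d i else 0)
      + (1 - \<alpha>) * (\<Sum>i<j. \<Sum>l<k. if (\<sigma> i, \<sigma> l) \<in> parcs G then 1 else 0)"
    by (simp only: sum.distrib sum_distrib_left)
  also have "(\<Sum>i<j. \<Sum>l<k. if i = l then ?d i else 0) = (\<Sum>i<min j k. ?d i)"
  proof -
    have "(\<Sum>i<j. \<Sum>l<k. if i = l then ?d i else 0) = (\<Sum>i<j. if i < k then ?d i else 0)"
      by (intro sum.cong refl) simp
    also have "\<dots> = (\<Sum>i\<in>{..<j} \<inter> {i. i < k}. ?d i)" by (simp add: sum.inter_restrict)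
    also have "{..<j} \<inter> {i. i < k} = {..<min j k}" by auto
    finally show ?thesis .
  qed
  also have "\<dots> = real (\<Sum>v\<in>\<sigma> ` {..<min j k}. out_degree (with_proj G) v)"
    using inj'[of "min j k"] assms(3) by (simp add: sum.reindex)
  also have "(\<Sum>i<j. \<Sum>l<k. if (\<sigma> i, \<sigma> l) \<in> parcs G then 1 else 0)
      = real (card (parcs G \<inter> \<sigma> ` {..<j} \<times> \<sigma> ` {..<k}))"
  proof -
    have "(\<Sum>i<j. \<Sum>l<k. if (\<sigma> i, \<sigma> l) \<in> parcs G then 1 else 0)
        = (\<Sum>u\<in>\<sigma> ` {..<j}. \<Sum>v\<in>\<sigma> ` {..<k}. if (u, v) \<in> parcs G then 1 else (0::real))"
      using inj'[OF assms(3)] inj'[OF assms(4)] by (simp add: sum.reindex)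
    also have "\<dots> = (\<Sum>e\<in>\<sigma> ` {..<j} \<times> \<sigma> ` {..<k}. if e \<in> parcs G then 1 else 0)"
      by (simp add: sum.cartesian_product case_prod_unfold)
    also have "\<dots> = (\<Sum>e\<in>(\<sigma> ` {..<j} \<times> \<sigma> ` {..<k}) \<inter> parcs G. 1)"
      by (rule sum.inter_restrict[symmetric]) simp
    finally show ?thesis by (simp add: Int_commute)
  qed
  finally show ?thesis .
qed

text \<open>Equality of multisets provides a permutation \<open>f\<close> from vertices to positions
  in \<pi>; any set of positions is then dominated by the initial one of the same size.\<close>

lemma sum_out_degree_le:
  assumes H: "pverts H = {0..<n}" "has_degree_sequence H \<pi>" and len: "length \<pi> = n"
    and sorted: "sorted_wrt (\<ge>) \<pi>" and S: "S \<subseteq> {..<n}"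
  shows "(\<Sum>v\<in>S. out_degree (with_proj H) v) \<le> (\<Sum>i<card S. \<pi> ! i)"
proof -
  let ?d = "out_degree (with_proj H)"
  have "mset (map ?d [0..<n]) = mset \<pi>"
    using H by (simp add: has_degree_sequence_def mset_upt)
  then obtain f where f: "f permutes {..<n}" "permute_list f \<pi> = map ?d [0..<n]"
    using mset_eq_permutation len by metis
  have d: "?d v = \<pi> ! f v" if "v < n" for v
  proof -
    have "?d v = map ?d [0..<n] ! v" using that by simp
    also have "\<dots> = \<pi> ! f v" unfolding f(2)[symmetric] using f(1) that len by (simp add: permute_list_nth)
    finally show ?thesis .
  qed
  have inj: "inj_on f S" using f(1) permutes_inj_on by blast
  have "sum ?d S = (\<Sum>v\<in>S. \<pi> ! f v)" using S d by (intro sum.cong) auto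
  also have "\<dots> = sum ((!) \<pi>) (f ` S)" using inj by (simp add: sum.reindex)
  also have "\<dots> \<le> sum ((!) \<pi>) {..<card (f ` S)}"
  proof (rule sum_antimono_le_initial)
    show "f ` S \<subseteq> {..<n}" using S f(1) permutes_image[OF f(1)] by blast
    show "\<pi> ! j \<le> \<pi> ! i" if "i \<le> j" "j < n" for i j
      using sorted len that by (cases "i = j") (auto simp: sorted_wrt_iff_nth_less)
  qed
  finally show ?thesis using inj by (simp add: card_image)
qed

lemma quadratic_form_le_spectral_radius_A_alpha:
  assumes G: "pair_graph G" "pverts G = {0..<n}"
    and y: "0 < (\<Sum>i<n. y i * y i)"
    and r: "r * (\<Sum>i<n. y i * y i) \<le> (\<Sum>i<n. \<Sum>j<n. A_alpha \<alpha> G $$ (i, j) * y i * y j)"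
  shows "r \<le> rho_alpha \<alpha> G"
proof -
  interpret pair_graph G by (fact G)
  have "A_alpha \<alpha> G $$ (i, j) = A_alpha \<alpha> G $$ (j, i)" if "i < n" "j < n" for i j
    using that G(2) arcs_symmetric by (auto simp: A_alpha_index)
  then show ?thesis
    unfolding rho_alpha_def
    using quadratic_form_le_spectral_radius[OF A_alpha_carrier[OF G(2)] _ y r] by blast
qed

lemma A_alpha_nonneg:
  assumes "pverts G = {0..<n}" "0 \<le> \<alpha>" "\<alpha> < 1" "i < n" "j < n"
  shows "0 \<le> A_alpha \<alpha> G $$ (i, j)"
  using assms by (simp add: A_alpha_index)

lemma rho_alpha_quadratic_form:
  assumes G: "pverts G = {0..<n}" and n: "0 < n" and \<alpha>: "0 \<le> \<alpha>" "\<alpha> < 1"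
  obtains x where "\<forall>i. 0 \<le> x i" "0 < (\<Sum>i<n. x i * x i)"
    "rho_alpha \<alpha> G * (\<Sum>i<n. x i * x i) \<le> (\<Sum>i<n. \<Sum>j<n. A_alpha \<alpha> G $$ (i, j) * x i * x j)"
  using abs_eigenvector_quadratic_form[OF A_alpha_carrier[OF G] n A_alpha_nonneg[OF G \<alpha>], folded rho_alpha_def] .

text \<open>Only nested pairs \<open>S\<close>, \<open>T\<close> occur in \<open>arcs\<close>,
  because the images of two initial segments under \<sigma> are always comparable.\<close>

lemma rho_alpha_le_if_rectangles_le:
  assumes \<alpha>: "0 \<le> \<alpha>" "\<alpha> < 1" and n: "0 < n"
    and H: "pverts H = {0..<n}" and U: "pair_graph U" "pverts U = {0..<n}"
    and degree: "\<And>S. S \<subseteq> {..<n} \<Longrightarrow>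
      (\<Sum>v\<in>S. out_degree (with_proj H) v) \<le> (\<Sum>i<card S. out_degree (with_proj U) i)"
    and arcs: "\<And>S T. T \<subseteq> {..<n} \<Longrightarrow> S \<subseteq> T \<or> T \<subseteq> S \<Longrightarrow> S \<subseteq> {..<n} \<Longrightarrow>
      card (parcs H \<inter> S \<times> T) \<le> card (parcs U \<inter> {..<card S} \<times> {..<card T})"
  shows "rho_alpha \<alpha> H \<le> rho_alpha \<alpha> U"
proof -
  obtain x where x: "\<forall>i. 0 \<le> x i" "0 < (\<Sum>i<n. x i * x i)"
    "rho_alpha \<alpha> H * (\<Sum>i<n. x i * x i) \<le> (\<Sum>i<n. \<Sum>j<n. A_alpha \<alpha> H $$ (i, j) * x i * x j)"
    using rho_alpha_quadratic_form[OF H n \<alpha>] .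
  obtain \<sigma> where \<sigma>: "bij_betw \<sigma> {..<n} {..<n}" "antimono_on {..<n} (x \<circ> \<sigma>)"
    using ex_antimono_permutation[of n x] .
  have anti: "x (\<sigma> j) \<le> x (\<sigma> i)" if "i \<le> j" "j < n" for i j
    using monotone_onD[OF \<sigma>(2), of i j] that by simp
  \<comment> \<open>\<open>y\<close> lists the values of \<open>x\<close> in nonincreasing order and
    is the test vector for \<open>U\<close>.\<close>
  define y where "y i = x (\<sigma> i)" for i
  have norm: "(\<Sum>i<n. y i * y i) = (\<Sum>i<n. x i * x i)"
    unfolding y_def by (rule sum.reindex_bij_betw[OF \<sigma>(1)])
  have "0 \<le> (\<Sum>i<n. \<Sum>l<n. (A_alpha \<alpha> U $$ (i, l) - A_alpha \<alpha> H $$ (\<sigma> i, \<sigma> l)) * y i * y l)"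
  proof (rule quadratic_form_antimono_nonneg)
    fix j k assume jk: "j \<le> n" "k \<le> n"
    have inj: "inj_on \<sigma> {..<m}" and sub: "\<sigma> ` {..<m} \<subseteq> {..<n}" if "m \<le> n" for m
      using \<sigma>(1) that inj_on_subset[of \<sigma> "{..<n}" "{..<m}"] by (auto simp: bij_betw_def)
    have card: "card (\<sigma> ` {..<m}) = m" if "m \<le> n" for m
      using inj[OF that] by (simp add: card_image)
    have nested: "\<sigma> ` {..<j} \<subseteq> \<sigma> ` {..<k} \<or> \<sigma> ` {..<k} \<subseteq> \<sigma> ` {..<j}"
      using image_mono[of "{..<j}" "{..<k}" \<sigma>] image_mono[of "{..<k}" "{..<j}" \<sigma>] by (cases "j \<le> k") auto
    have "(\<Sum>v\<in>\<sigma> ` {..<min j k}. out_degree (with_proj H) v) \<le> (\<Sum>i<min j k. out_degree (with_proj U) i)"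
      using degree[OF sub[of "min j k"]] card[of "min j k"] jk by simp
    moreover have "card (parcs H \<inter> \<sigma> ` {..<j} \<times> \<sigma> ` {..<k}) \<le> card (parcs U \<inter> {..<j} \<times> {..<k})"
      using arcs[OF sub[OF jk(2)] nested sub[OF jk(1)]] card jk by simp
    moreover have "(\<Sum>i<j. \<Sum>l<k. A_alpha \<alpha> U $$ (i, l))
        = \<alpha> * real (\<Sum>i<min j k. out_degree (with_proj U) i)
          + (1 - \<alpha>) * real (card (parcs U \<inter> {..<j} \<times> {..<k}))"
      using sum_A_alpha_rectangle[OF U(2) bij_betw_id jk, of \<alpha>] by simp
    ultimately have "(\<Sum>i<j. \<Sum>l<k. A_alpha \<alpha> H $$ (\<sigma> i, \<sigma> l)) \<le> (\<Sum>i<j. \<Sum>l<k. A_alpha \<alpha> U $$ (i, l))"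
      using \<alpha> unfolding sum_A_alpha_rectangle[OF H \<sigma>(1) jk]
      by (simp only:) (intro add_mono mult_left_mono of_nat_mono; simp)
    then show "0 \<le> (\<Sum>i<j. \<Sum>l<k. A_alpha \<alpha> U $$ (i, l) - A_alpha \<alpha> H $$ (\<sigma> i, \<sigma> l))"
      by (simp add: sum_subtractf)
  qed (use x(1) anti in \<open>auto simp: y_def\<close>)
  then have "(\<Sum>i<n. \<Sum>l<n. A_alpha \<alpha> H $$ (\<sigma> i, \<sigma> l) * y i * y l)
      \<le> (\<Sum>i<n. \<Sum>l<n. A_alpha \<alpha> U $$ (i, l) * y i * y l)"
    by (simp add: left_diff_distrib sum_subtractf)
  moreover have "(\<Sum>i<n. \<Sum>l<n. A_alpha \<alpha> H $$ (\<sigma> i, \<sigma> l) * y i * y l)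
      = (\<Sum>i<n. \<Sum>l<n. A_alpha \<alpha> H $$ (i, l) * x i * x l)"
  proof -
    have "(\<Sum>i<n. \<Sum>l<n. A_alpha \<alpha> H $$ (\<sigma> i, \<sigma> l) * y i * y l)
        = (\<Sum>i<n. \<Sum>l<n. A_alpha \<alpha> H $$ (\<sigma> i, l) * x (\<sigma> i) * x l)"
      unfolding y_def
      by (intro sum.cong refl sum.reindex_bij_betw[OF \<sigma>(1), where g = "\<lambda>l. A_alpha \<alpha> H $$ (\<sigma> _, l) * x (\<sigma> _) * x l"])
    also have "\<dots> = (\<Sum>i<n. \<Sum>l<n. A_alpha \<alpha> H $$ (i, l) * x i * x l)"
      by (rule sum.reindex_bij_betw[OF \<sigma>(1), where g = "\<lambda>i. \<Sum>l<n. A_alpha \<alpha> H $$ (i, l) * x i * x l"])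
    finally show ?thesis .
  qed
  ultimately show ?thesis
    using x(2,3) norm by (intro quadratic_form_le_spectral_radius_A_alpha[OF U, of y]) auto
qed

section \<open>Arc bounds valid in every unicyclic graph\<close>

lemma sym_card_arcs_swap:
  assumes "sym E"
  shows "card (E \<inter> S \<times> T) = card (E \<inter> T \<times> S)"
proof -
  have "E \<inter> T \<times> S = prod.swap ` (E \<inter> S \<times> T)"
    using assms by (force simp: sym_def image_iff)
  then show ?thesis by (simp add: card_image)
qed

lemma unicyclic_sym: "unicyclic H \<Longrightarrow> sym (parcs H)"
  using pair_sym_digraph.pair_sym_arcs[of H]
  by (simp add: unicyclic_def symmetric_def pair_graph_def pair_pseudo_graph_def)

lemma unicyclic_irrefl: "unicyclic H \<Longrightarrow> irrefl (parcs H)"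
  using pair_loopfree_digraph.pair_no_loops[of H]
  by (force simp: unicyclic_def irrefl_def pair_graph_def pair_digraph_def)

text \<open>Two vertices span at most one edge, which improves the general bound; this is the
  exception needed to match the breadth-first graph exactly.\<close>

lemma unicyclic_card_arcs_within:
  assumes H: "unicyclic H" and S: "finite S"
  shows "card (parcs H \<inter> S \<times> S) \<le> 2 * (if card S = 2 then 1 else card S)"
proof (cases "card S = 2")
  case True
  obtain a b where S: "S = {a, b}" using True by (auto simp: card_2_iff)
  have "parcs H \<inter> S \<times> S \<subseteq> set [(a, b), (b, a)]" using unicyclic_irrefl[OF H] by (auto simp: S irrefl_def)
  then have "card (parcs H \<inter> S \<times> S) \<le> card (set [(a, b), (b, a)])" by (intro card_mono) auto
  also have "\<dots> \<le> 2" using card_length[of "[(a, b), (b, a)]"] by simp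
  finally show ?thesis using True by simp
next
  case False
  then show ?thesis using unicyclic_card_arcs[OF H S] by simp
qed

lemma unicyclic_card_arcs_nested:
  assumes H: "unicyclic H" and ST: "S \<subseteq> T" "finite T"
  shows "card (parcs H \<inter> S \<times> T) \<le> (if card S = 2 then 1 else card S) + (if card T = 2 then 1 else card T)"
proof -
  have "2 * card (parcs H \<inter> S \<times> T) \<le> card (parcs H \<inter> S \<times> S) + card (parcs H \<inter> T \<times> T)"
    using unicyclic_sym[OF H] ST by (intro sym_card_arcs_nested)
  then show ?thesis
    using unicyclic_card_arcs_within[OF H, of S] unicyclic_card_arcs_within[OF H ST(2)]
      finite_subset[OF ST] by linarith
qed

lemma unicyclic_card_arcs_le_sum_out_degree:
  assumes "unicyclic G" "finite S"
  shows "card (parcs G \<inter> S \<times> T) \<le> (\<Sum>v\<in>S. out_degree (with_proj G) v)"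
proof -
  interpret pair_graph G using assms(1) by (simp add: unicyclic_def)
  have "card (parcs G \<inter> S \<times> T) \<le> card (\<Union>v\<in>S. {e \<in> parcs G. fst e = v})"
    using assms(2) pair_finite_arcs by (intro card_mono) auto
  also have "\<dots> \<le> (\<Sum>v\<in>S. card {e \<in> parcs G. fst e = v})"
    by (rule card_UN_le[OF assms(2)])
  finally show ?thesis by (simp add: out_degree_def out_arcs_def)
qed

context bfs_degrees
begin

text \<open>Each case pairs an upper bound for \<open>H\<close> with a count in
  \<open>bfs_graph\<close>: the degree sum if all new neighbours of the first \<open>card S\<close>
  vertices fit, the neighbour count for a single vertex, and otherwise the edge bound for nested
  sets.\<close>

lemma unicyclic_card_arcs_le_bfs_graph:
  assumes H: "H \<in> unicyclic_graphs \<pi>" and ST: "S \<subseteq> T" "T \<subseteq> {..<n}"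
  shows "card (parcs H \<inter> S \<times> T) \<le> card (parcs bfs_graph \<inter> {..<card S} \<times> {..<card T})"
proof -
  have uni: "unicyclic H" and V: "pverts H = {0..<n}" and deg: "has_degree_sequence H \<pi>"
    using H length_seq by (auto simp: unicyclic_graphs_def)
  have fin: "finite T" "finite S" 
    using finite_subset[OF ST(2)] finite_subset[OF subset_trans[OF ST]] by simp_all
  have jk: "card S \<le> card T" "card T \<le> n"
    using card_mono[OF fin(1) ST(1)] card_mono[OF _ ST(2)] by simp_all
  show ?thesis
  proof (cases "first_new \<pi> (card S) \<le> card T")
    case True
    have "card (parcs H \<inter> S \<times> T) \<le> (\<Sum>v\<in>S. out_degree (with_proj H) v)"
      by (rule unicyclic_card_arcs_le_sum_out_degree[OF uni fin(2)])
    also have "\<dots> \<le> (\<Sum>i<card S. \<pi> ! i)"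
      using sum_out_degree_le[OF V deg length_seq antimono] ST by blast
    also have "\<dots> \<le> card (parcs bfs_graph \<inter> {..<card S} \<times> {..<card T})"
      by (rule sum_seq_le_card_arcs[OF jk True])
    finally show ?thesis .
  next
    case False
    consider "card S = 0" | "card S = 1" | "2 \<le> card S" by linarith
    then show ?thesis
    proof cases
      case 1
      then show ?thesis using fin by simp
    next
      case 2
      then obtain s where s: "S = {s}" by (auto simp: card_1_singleton_iff)
      have "parcs H \<inter> S \<times> T \<subseteq> Pair s ` (T - {s})" using unicyclic_irrefl[OF uni] by (auto simp: s irrefl_def)
      then have "card (parcs H \<inter> S \<times> T) \<le> card (Pair s ` (T - {s}))"
        using fin by (intro card_mono) auto
      also have "\<dots> = card T - 1" using s ST(1) fin by (simp add: card_image inj_on_def)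
      also have "\<dots> \<le> card (parcs bfs_graph \<inter> {..<1} \<times> {..<card T})"
        using False jk(2) 2 by (intro card_arcs_first_vertex) auto
      finally show ?thesis by (simp only: 2)
    next
      case 3
      have "card (parcs H \<inter> S \<times> T)
          \<le> (if card S = 2 then 1 else card S) + (if card T = 2 then 1 else card T)"
        by (rule unicyclic_card_arcs_nested[OF uni ST(1) fin(1)])
      also have "\<dots> \<le> card (parcs bfs_graph \<inter> {..<card S} \<times> {..<card T})"
        using False by (intro card_arcs_initial[OF 3 jk]) simp
      finally show ?thesis .
    qed
  qed
qed

lemma rho_alpha_le_bfs_graph:
  assumes H: "H \<in> unicyclic_graphs \<pi>" and \<alpha>: "0 \<le> \<alpha>" "\<alpha> < 1"
  shows "rho_alpha \<alpha> H \<le> rho_alpha \<alpha> bfs_graph"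
proof -
  have uni: "unicyclic H" and V: "pverts H = {0..<n}" and deg: "has_degree_sequence H \<pi>"
    using H length_seq by (auto simp: unicyclic_graphs_def)
  have symU: "sym (parcs bfs_graph)" using graph.pair_sym_arcs by (simp add: symmetric_def)
  show ?thesis
  proof (rule rho_alpha_le_if_rectangles_le[OF \<alpha> _ V graph.pair_graph pverts_bfs_graph])
    show "0 < n" using three_le by simp
  next
    fix S assume S: "S \<subseteq> {..<n}"
    have "card S \<le> n" using card_mono[OF _ S] by simp
    then have "(\<Sum>i<card S. out_degree (with_proj bfs_graph) i) = (\<Sum>i<card S. \<pi> ! i)"
      by (intro sum.cong) (simp_all add: out_degree_bfs_graph)
    then show "(\<Sum>v\<in>S. out_degree (with_proj H) v) \<le> (\<Sum>i<card S. out_degree (with_proj bfs_graph) i)"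
      using sum_out_degree_le[OF V deg length_seq antimono S] by simp
  next
    fix S T assume ST: "T \<subseteq> {..<n}" "S \<subseteq> T \<or> T \<subseteq> S" "S \<subseteq> {..<n}"
    then show "card (parcs H \<inter> S \<times> T) \<le> card (parcs bfs_graph \<inter> {..<card S} \<times> {..<card T})"
      using unicyclic_card_arcs_le_bfs_graph[OF H, of S T] unicyclic_card_arcs_le_bfs_graph[OF H, of T S]
        sym_card_arcs_swap[OF unicyclic_sym[OF uni], of S T] sym_card_arcs_swap[OF symU, of "{..<card S}" "{..<card T}"]
      by auto
  qed
qed

end

section \<open>Regular graphs and the cycle\<close>

lemma A_alpha_row_sum:
  assumes G: "pair_graph G" "pverts G = {0..<n}" and i: "i < n"
  shows "(\<Sum>l<n. A_alpha \<alpha> G $$ (i, l)) = real (out_degree (with_proj G) i)"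
proof -
  interpret pair_graph G by (fact G)
  let ?d = "out_degree (with_proj G) i"
  have "{e \<in> parcs G. fst e = i} = Pair i ` {l \<in> {..<n}. (i, l) \<in> parcs G}"
    using in_arcsD2 G(2) by auto
  then have d: "?d = card {l \<in> {..<n}. (i, l) \<in> parcs G}"
    by (simp add: out_degree_def out_arcs_def card_image inj_on_def)
  have "(\<Sum>l<n. A_alpha \<alpha> G $$ (i, l))
      = (\<Sum>l<n. \<alpha> * (if i = l then real ?d else 0) + (1 - \<alpha>) * (if (i, l) \<in> parcs G then 1 else 0))"
    using A_alpha_index[OF G(2) i] by (intro sum.cong) auto
  also have "\<dots> = \<alpha> * (\<Sum>l<n. if i = l then real ?d else 0) + (1 - \<alpha>) * (\<Sum>l<n. if (i, l) \<in> parcs G then 1 else 0)"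
    by (simp only: sum.distrib sum_distrib_left)
  also have "(\<Sum>l<n. if i = l then real ?d else 0) = real ?d" using i by simp
  also have "(\<Sum>l<n. if (i, l) \<in> parcs G then 1 else (0::real)) = real ?d"
    unfolding d by (simp flip: sum.inter_filter)
  finally show ?thesis by (simp add: algebra_simps)
qed

text \<open>All row sums are \<open>d\<close>. The upper bound uses 2ab \<le> a^2 + b^2 in each term
  of the quadratic form, the lower bound the all-ones vector.\<close>

lemma rho_alpha_regular:
  assumes G: "pair_graph G" "pverts G = {0..<n}" and n: "0 < n" and \<alpha>: "0 \<le> \<alpha>" "\<alpha> < 1"
    and deg: "\<And>v. v < n \<Longrightarrow> out_degree (with_proj G) v = d"
  shows "rho_alpha \<alpha> G = real d"
proof (rule antisym)
  interpret pair_graph G by (fact G)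
  let ?A = "\<lambda>i j. A_alpha \<alpha> G $$ (i, j)"
  have row: "(\<Sum>l<n. ?A i l) = real d" if "i < n" for i
    using A_alpha_row_sum[OF G that] deg[OF that] by simp
  have sym: "?A i j = ?A j i" if "i < n" "j < n" for i j
    using that G(2) arcs_symmetric by (auto simp: A_alpha_index)
  obtain x where x: "\<forall>i. 0 \<le> x i" "0 < (\<Sum>i<n. x i * x i)"
    "rho_alpha \<alpha> G * (\<Sum>i<n. x i * x i) \<le> (\<Sum>i<n. \<Sum>j<n. ?A i j * x i * x j)"
    using rho_alpha_quadratic_form[OF G(2) n \<alpha>] .
  have "(\<Sum>i<n. \<Sum>j<n. ?A i j * x i * x j) \<le> (\<Sum>i<n. \<Sum>j<n. ?A i j * (x i * x i) / 2 + ?A i j * (x j * x j) / 2)"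
  proof (intro sum_mono)
    fix i j assume "i \<in> {..<n}" "j \<in> {..<n}"
    then have "?A i j * (2 * (x i * x j)) \<le> ?A i j * (x i * x i + x j * x j)"
      using sum_squares_bound[of "x i" "x j"] A_alpha_nonneg[OF G(2) \<alpha>]
      by (intro mult_left_mono) (auto simp: power2_eq_square)
    then show "?A i j * x i * x j \<le> ?A i j * (x i * x i) / 2 + ?A i j * (x j * x j) / 2"
      by (simp add: field_simps)
  qed
  also have "\<dots> = (\<Sum>i<n. \<Sum>j<n. ?A i j * (x i * x i) / 2) + (\<Sum>i<n. \<Sum>j<n. ?A i j * (x j * x j) / 2)"
    by (simp only: sum.distrib)
  also have "(\<Sum>i<n. \<Sum>j<n. ?A i j * (x j * x j) / 2) = (\<Sum>j<n. \<Sum>i<n. ?A j i * (x j * x j) / 2)"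
    by (subst sum.swap) (intro sum.cong refl, use sym in simp)
  also have "(\<Sum>i<n. \<Sum>j<n. ?A i j * (x i * x i) / 2) = real d * (\<Sum>i<n. x i * x i) / 2"
  proof -
    have "(\<Sum>i<n. \<Sum>j<n. ?A i j * (x i * x i) / 2) = (\<Sum>i<n. (\<Sum>j<n. ?A i j) * (x i * x i) / 2)"
      by (simp only: sum_distrib_right sum_divide_distrib)
    also have "\<dots> = (\<Sum>i<n. real d * (x i * x i) / 2)"
      using row by (intro sum.cong) simp_all
    finally show ?thesis by (simp only: sum_distrib_left sum_divide_distrib)
  qed
  finally have "rho_alpha \<alpha> G * (\<Sum>i<n. x i * x i) \<le> real d * (\<Sum>i<n. x i * x i)"
    using x(3) by simp
  then show "rho_alpha \<alpha> G \<le> real d" using x(2) by simp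
  show "real d \<le> rho_alpha \<alpha> G"
    using row n by (intro quadratic_form_le_spectral_radius_A_alpha[OF G, of "\<lambda>_. 1"]) simp_all
qed

section \<open>The cycle on \<open>n\<close> vertices\<close>

lemma Suc_mod_eq: "i < n \<Longrightarrow> Suc i mod n = (if Suc i = n then 0 else Suc i)"
  by (simp add: mod_Suc)

context
  fixes n :: nat
  assumes n: "3 \<le> n"
begin

lemma cycle_graph_arcs_iff:
  assumes "u < n"
  shows "(u, v) \<in> parcs (undirected n (cycle_edges n))
    \<longleftrightarrow> v = (u + 1) mod n \<or> v = (if u = 0 then n - 1 else u - 1)"
proof -
  have "v < n \<and> u = (v + 1) mod n \<longleftrightarrow> v = (if u = 0 then n - 1 else u - 1)"
    using assms n by (cases "v < n") (auto simp: Suc_mod_eq)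
  then show ?thesis using assms by (auto simp: undirected_def cycle_edges_def)
qed

lemma cycle_edges_subset: "cycle_edges n \<subseteq> {0..<n} \<times> {0..<n}"
  using n by (auto simp: cycle_edges_def)

lemma pair_graph_cycle_graph: "pair_graph (undirected n (cycle_edges n))"
proof (rule pair_graph_undirected[OF cycle_edges_subset], rule irreflI)
  fix a
  show "(a, a) \<notin> cycle_edges n" using n by (auto simp: cycle_edges_def Suc_mod_eq split: if_splits)
qed

lemma out_degree_cycle_graph:
  assumes "i < n"
  shows "out_degree (with_proj (undirected n (cycle_edges n))) i = 2"
proof -
  define s p where "s = (i + 1) mod n" and "p = (if i = 0 then n - 1 else i - 1)"
  have iff: "(i, v) \<in> parcs (undirected n (cycle_edges n)) \<longleftrightarrow> v = s \<or> v = p" for v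
    unfolding s_def p_def by (rule cycle_graph_arcs_iff[OF assms])
  have "{e \<in> parcs (undirected n (cycle_edges n)). fst e = i} = Pair i ` {s, p}"
    by (auto simp: iff)
  moreover have "s \<noteq> p" using assms n by (auto simp: s_def p_def Suc_mod_eq)
  ultimately show ?thesis by (simp add: out_degree_def out_arcs_def card_image inj_on_def)
qed

lemma connected_cycle_graph:
  "Digraph_Component.connected (with_proj (undirected n (cycle_edges n)))"
proof (rule connected_undirected[OF cycle_edges_subset])
  show "0 < n" using n by simp
  fix v assume "0 < v" "v < n"
  then have "(v - 1, v) \<in> cycle_edges n" by (auto simp: cycle_edges_def intro!: exI[of _ "v - 1"])
  then show "\<exists>u<v. (u, v) \<in> cycle_edges n" using \<open>0 < v\<close> by (intro exI[of _ "v - 1"]) simp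
qed

text \<open>A vertex on a cycle has two distinct neighbours on it, and the graph offers only two, so
  the successor modulo \<open>n\<close> is on the cycle as well. Iterating shows that the cycle runs
  through all vertices and edges.\<close>

lemma cycle_edge_sets_cycle_graph:
  "cycle_edge_sets (undirected n (cycle_edges n)) = {(\<lambda>(u, v). {u, v}) ` cycle_edges n}"
proof -
  let ?G = "undirected n (cycle_edges n)" and ?e = "\<lambda>(u, v). {u, v}"
  interpret pair_graph ?G by (rule pair_graph_cycle_graph)
  have all: "?e ` set (zip vs (rotate1 vs)) = ?e ` cycle_edges n"
    if vs: "distinct vs" "3 \<le> length vs" "set (zip vs (rotate1 vs)) \<subseteq> parcs ?G" for vs
  proof -
    let ?Z = "set (zip vs (rotate1 vs))"
    have step: "{v, (v + 1) mod n} \<in> ?e ` ?Z \<and> (v + 1) mod n \<in> set vs" if v: "v \<in> set vs" for v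
    proof -
      obtain x y where xy: "x \<noteq> y" "(x, v) \<in> ?Z" "(v, y) \<in> ?Z"
        using zip_rotate1_neighbours[OF vs(1,2) v] .
      have arcs: "(v, x) \<in> parcs ?G" "(v, y) \<in> parcs ?G"
        using xy vs(3) arcs_symmetric by blast+
      have "v < n" using in_arcsD1[OF arcs(1)] by (simp add: undirected_def)
      then have "x = (v + 1) mod n \<or> y = (v + 1) mod n"
        using arcs xy(1) cycle_graph_arcs_iff by metis
      moreover have "{v, x} \<in> ?e ` ?Z" "{v, y} \<in> ?e ` ?Z"
        using xy(2,3) by (auto simp: image_iff insert_commute intro: bexI[of _ "(x, v)"] bexI[of _ "(v, y)"])
      moreover have "x \<in> set vs" "y \<in> set vs"
        using set_zip_rotate1D(1)[OF xy(2)] set_zip_rotate1D(2)[OF xy(3)] .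
      ultimately show ?thesis by metis
    qed
    obtain v where v: "v \<in> set vs" using vs(2) by (cases vs) auto
    obtain y where "(v, y) \<in> ?Z" using zip_rotate1_neighbours[OF vs(1,2) v] by metis
    then have "(v, y) \<in> parcs ?G" using vs(3) by blast
    then have vn: "v < n" using in_arcsD1 by (fastforce simp: undirected_def)
    have orbit: "(v + k) mod n \<in> set vs" for k
    proof (induction k)
      case 0
      then show ?case using v vn by simp
    next
      case (Suc k)
      then have "((v + k) mod n + 1) mod n \<in> set vs" using step by blast
      then show ?case by (simp add: mod_simps)
    qed
    \<comment> \<open>\<open>n - v + i\<close> steps lead from \<open>v\<close> to
      \<open>n + i\<close>, which is \<open>i\<close> modulo \<open>n\<close>.\<close>
    have "i \<in> set vs" if "i < n" for i
      using orbit[of "n - v + i"] that vn by simp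
    then have "?e ` cycle_edges n \<subseteq> ?e ` ?Z"
      using step by (auto simp: cycle_edges_def)
    moreover have "?e ` ?Z \<subseteq> ?e ` cycle_edges n"
    proof
      fix s assume "s \<in> ?e ` ?Z"
      then obtain a b where "s = {a, b}" "(a, b) \<in> parcs ?G" using vs(3) by auto
      then have "s = {a, b}" "(a, b) \<in> cycle_edges n \<or> (b, a) \<in> cycle_edges n"
        by (auto simp: undirected_def)
      then show "s \<in> ?e ` cycle_edges n"
        by (auto simp: image_iff insert_commute intro: bexI[of _ "(a, b)"] bexI[of _ "(b, a)"])
    qed
    ultimately show ?thesis by blast
  qed
  have Z: "set (zip [0..<n] (rotate1 [0..<n])) = cycle_edges n"
  proof -
    have "set (zip [0..<n] (rotate1 [0..<n])) = (\<lambda>i. ([0..<n] ! i, rotate1 [0..<n] ! i)) ` {..<n}"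
      by (auto simp: set_zip simp del: nth_upt)
    also have "\<dots> = (\<lambda>i. (i, (i + 1) mod n)) ` {..<n}"
      by (intro image_cong refl) (simp add: nth_rotate1)
    also have "\<dots> = cycle_edges n" by (auto simp: cycle_edges_def)
    finally show ?thesis .
  qed
  moreover have "cycle_edges n \<subseteq> parcs ?G" by (auto simp: undirected_def)
  ultimately have mem: "?e ` cycle_edges n \<in> cycle_edge_sets ?G"
    unfolding cycle_edge_sets_rotate1 using n
    by (intro CollectI exI[of _ "[0..<n]"]) simp
  show ?thesis
  proof (intro equalityI subsetI)
    fix C assume "C \<in> cycle_edge_sets ?G"
    then obtain vs where "C = ?e ` set (zip vs (rotate1 vs))" "distinct vs" "3 \<le> length vs"
      "set (zip vs (rotate1 vs)) \<subseteq> parcs ?G"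
      unfolding cycle_edge_sets_rotate1 by blast
    then show "C \<in> {?e ` cycle_edges n}" using all by simp
  next
    fix C assume "C \<in> {?e ` cycle_edges n}"
    then show "C \<in> cycle_edge_sets ?G" using mem by simp
  qed
qed

lemma unicyclic_cycle_graph: "unicyclic (undirected n (cycle_edges n))"
  unfolding unicyclic_def cycle_edge_sets_cycle_graph singleton_iff
  using pair_graph_cycle_graph connected_cycle_graph by blast

end

theorem theorem1p2:
  fixes n :: nat and \<pi> :: "nat list" and \<alpha> :: real
  assumes "3 \<le> n"
    and "length \<pi> = n"
    and "sorted_wrt (\<ge>) \<pi>"
    and "\<forall>d \<in> set \<pi>. 0 < d"
    and "sum_list \<pi> = 2 * n"
    and "2 \<le> \<pi> ! 2"
    and "0 \<le> \<alpha>" and "\<alpha> < 1"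
  shows "rho_alpha \<alpha> (U_star \<pi>) = Max {rho_alpha \<alpha> H | H. H \<in> unicyclic_graphs \<pi>}"
proof -
  have "U_star \<pi> \<in> unicyclic_graphs \<pi> \<and> (\<forall>H \<in> unicyclic_graphs \<pi>. rho_alpha \<alpha> H \<le> rho_alpha \<alpha> (U_star \<pi>))"
  proof (cases "3 \<le> \<pi> ! 0")
    case True
    interpret bfs_degrees \<pi> n using assms True by unfold_locales auto
    show ?thesis
      unfolding U_star_eq_bfs_graph
      using bfs_graph_unicyclic rho_alpha_le_bfs_graph assms(7,8) by blast
  next
    case False
    have le: "\<pi> ! i \<le> 2" if "i < n" for i
      using assms(2,3) False that by (cases "i = 0") (fastforce simp: sorted_wrt_iff_nth_less)+
    \<comment> \<open>No entry exceeds 2 and the average is 2, so every entry is 2.\<close>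
    have two: "\<pi> ! i = 2" if i: "i < n" for i
    proof (rule ccontr)
      assume "\<pi> ! i \<noteq> 2"
      then have "\<pi> ! i < 2" using le[OF i] by simp
      then have "(\<Sum>i<n. \<pi> ! i) < (\<Sum>i<n. 2)"
        using le i by (intro sum_strict_mono_ex1) auto
      then show False using assms(2,5) by (simp add: sum_list_sum_nth lessThan_atLeast0)
    qed
    then have seq: "\<pi> = replicate n 2" using assms(2) by (intro nth_equalityI) auto
    \<comment> \<open>Every graph in question is 2-regular, so all spectral radii coincide and only
      membership of the cycle remains to be shown.\<close>
    have regular: "rho_alpha \<alpha> H = 2" if H: "H \<in> unicyclic_graphs \<pi>" for H
    proof -
      have V: "pverts H = {0..<n}" and deg: "has_degree_sequence H \<pi>" and pg: "pair_graph H"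
        using H assms(2) by (auto simp: unicyclic_graphs_def unicyclic_def)
      have "out_degree (with_proj H) v = 2" if "v < n" for v
      proof -
        have "out_degree (with_proj H) v \<in># image_mset (out_degree (with_proj H)) (mset_set (pverts H))"
          using that V by simp
        then have "out_degree (with_proj H) v \<in> set \<pi>"
          using deg unfolding has_degree_sequence_def by simp
        then show ?thesis by (simp add: seq)
      qed
      then have "rho_alpha \<alpha> H = real 2"
        using assms(1) by (intro rho_alpha_regular[OF pg V _ assms(7,8)]) auto
      then show ?thesis by simp
    qed
    have "\<pi> ! 0 = 2" using two assms(1) by simp
    then have U: "U_star \<pi> = undirected n (cycle_edges n)" by (simp add: U_star_def assms(2))
    have "image_mset (out_degree (with_proj (undirected n (cycle_edges n)))) (mset_set {0..<n})
        = image_mset (\<lambda>_. 2) (mset_set {0..<n})"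
      using out_degree_cycle_graph[OF assms(1)] by (intro image_mset_cong) simp
    then have "has_degree_sequence (undirected n (cycle_edges n)) \<pi>"
      by (simp add: has_degree_sequence_def seq undirected_def image_mset_const_eq)
    then have "U_star \<pi> \<in> unicyclic_graphs \<pi>"
      using unicyclic_cycle_graph[OF assms(1)]
      by (simp add: U unicyclic_graphs_def assms(2) undirected_def)
    then show ?thesis using regular by simp
  qed
  moreover have "finite {rho_alpha \<alpha> H | H. H \<in> unicyclic_graphs \<pi>}"
    using finite_unicyclic_graphs by simp
  ultimately show ?thesis by (intro Max_eqI[symmetric]) auto
qed

end
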